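(* Let $B$ be an admissible gain box. If $\phi_B>0$, then, for every $\Lambda\in B$ and as $\varepsilon\downarrow0$, $$\operatorname{vol}S\bigl(\Lambda,\varepsilon\rho^\star(\Lambda)\bigr)=\frac{\kappa_n\bigl(\rho^\star(\Lambda)\bigr)^n}{\sqrt{\det\bar P_I}}\,\varepsilon^n+o(\varepsilon^n),\qquad\kappa_n:=\frac{\pi^{n/2}}{\Gamma(n/2+1)}.$$ Hence the problem of minimizing $\phi$ (equivalently, maximizing $\rho^\star=1/\phi$) over $B$ ranks gains exactly by the leading coefficients of these scaled certified volumes: for $\Lambda_1,\Lambda_2\in B$, $\rho^\star(\Lambda_1)\le\rho^\star(\Lambda_2)$ if and only if the coefficient of $\varepsilon^n$ for $\Lambda_1$ is at most that for $\Lambda_2$. If $\phi_B=0$, there is instead an optimizing gain $\Lambda\in B$ for which $V(\mathbf w)=\mathbf w^{\top}P(\Lambda)\mathbf w$ is a global quadratic Lyapunov function for $\dot{\mathbf w}=\mathbf F_\Lambda(\mathbf w)$.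
   Context: Polynomial system: $\dot{\mathbf x}=\mathbf p(\mathbf x)$ with $\mathbf p\in\mathbb{R}[\mathbf x]^n$, $\mathbf p(\mathbf 0)=\mathbf 0$, and the standing assumption that the Jacobian $J_p=J_x(\mathbf p)|_{\mathbf 0}$ is Hurwitz (all eigenvalues have negative real part). $\lVert\cdot\rVert$ is the spectral norm. Fixed lift: $m\ge0$, $N=n+m$, $\mathbf g=(g_1,\dots,g_m)$ with each $g_i$ a monomial in $\mathbf x$ of degree at least $2$; $\Phi(\mathbf x)=(\mathbf x,\mathbf g(\mathbf x))\in\mathbb{R}^N$; coordinates $\mathbf w=(\mathbf x,\mathbf y)$. The lift is inner-quadratic: for each $i$ a factorization $g_i=a_ib_i$ is fixed, with $a_i,b_i\in\{x_1,\dots,x_n,y_1,\dots,y_{i-1}\}$ (the identity holding after substituting $\mathbf y=\mathbf g(\mathbf x)$). Stabilizers: $h_i=y_i-a_ib_i$. Reference extension: $\mathbf F_0(\mathbf w)=A_0\mathbf w+H_0(\mathbf w\otimes\mathbf w)$, a vector field on $\mathbb{R}^N$ with polynomial components of total degree at most two, satisfying $\mathbf F_0(\Phi(\mathbf x))=J_x(\Phi)(\mathbf x)\mathbf p(\mathbf x)$ for all $\mathbf x$. Stabilized family: for $\Lambda\in\mathbb{R}^m$, $\mathbf F_\Lambda=\mathbf F_0-\sum_i\lambda_i\mathbf e_{n+i}h_i=A(\Lambda)\mathbf w+H(\Lambda)(\mathbf w\otimes\mathbf w)$ with $A(\Lambda)=A_0-\sum_i\lambda_i\mathbf e_{n+i}\mathbf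 e_{n+i}^{\top}$, $H(\Lambda)=H_0+\sum_i\lambda_i\mathbf e_{n+i}s_i^{\top}$, where $s_i\in\mathbb{R}^{N^2}$ satisfies $s_i^{\top}(\mathbf w\otimes\mathbf w)=a_ib_i$. Let $\mathcal F=\{\Lambda:A(\Lambda)\text{ Hurwitz}\}$. Gauge: let $\mathcal K=\{K\in\mathbb{R}^{N\times N^2}:K(\mathbf w\otimes\mathbf w)=0\ \forall\mathbf w\}$, of dimension $d=\frac12N^2(N-1)$, with fixed basis $\{K_k\}$; $K(\mu)=\sum_k\mu_kK_k$ and $H(\Lambda,\mu)=H(\Lambda)+K(\mu)$, $\mu\in\mathbb{R}^d$. Certificate: for $\Lambda\in\mathcal F$, $P(\Lambda)\succ0$ is the unique solution of $A(\Lambda)^{\top}P+PA(\Lambda)=-I_N$, factored as $P=P_f^{\top}P_f$. With blocks $(M_i)_{rj}:=(H(\Lambda,\mu))_{r,(i-1)N+j}$, let $G(\Lambda,\mu)\in\mathbb{R}^{N^2\times N}$ be the vertical stacking of $M_i^{\top}P+PM_i$, $i=1,\dots,N$, and $J(\Lambda,\mu):=(P_f^{\top}\otimes I_N)^{-1}G(\Lambda,\mu)$. Put $\phi(\Lambda)=\min_{\mu\in\mathbb{R}^d}\lVert J(\Lambda,\mu)\rVert$ and $\rho^\star(\Lambda)=1/\phi(\Lambda)$ with $1/0:=+\infty$. An admissible gain box is a nonempty closed box $B=[\underline\Lambda,\overline\Lambda]\subset\mathbb{R}^m$ contained in $\mathcal F$; $\phi_B:=\min_{\Lambda\in B}\phi(\Lambda)$.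 Pullback: $S(\Lambda,\rho):=\{\mathbf x\in\mathbb{R}^n:\Phi(\mathbf x)^{\top}P(\Lambda)\Phi(\mathbf x)\le\rho^2\}$. $\bar P_I\in\mathbb{R}^{n\times n}$ is the unique solution of $J_p^{\top}\bar P_I+\bar P_IJ_p=-I_n$ (it equals the leading $n\times n$ block of $P(\Lambda)$ for every $\Lambda\in\mathcal F$). A positive definite quadratic form is a global Lyapunov function if its derivative along the system is negative at every nonzero $\mathbf w$. *)

theory Defs
  imports "HOL-Analysis.Analysis" "HOL-Library.Landau_Symbols"
begin

text \<open>
  The state space \<open>\<real>\<^sup>n\<close> is \<open>real ^ 'n\<close> and the lifted space \<open>\<real>\<^sup>N\<close>, \<open>N = n + m\<close>, is \<open>real ^ 'k\<close>.
  Because \<open>m = 0\<close> is allowed, \<open>'k\<close> is not a sum type: the coordinates \<open>x\<^sub>j\<close> of \<open>\<real>\<^sup>N\<close> sit at the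
  indices \<open>xi D j\<close>, and \<open>y\<^sub>1, \<dots>, y\<^sub>m\<close> at \<open>yi D 0, \<dots>, yi D (m - 1)\<close> (so \<open>i\<close> is counted from 0).
  Elements of \<open>\<real>\<^sup>m\<close> and \<open>\<real>\<^sup>d\<close> are extensional functions on \<open>{..<m}\<close> and \<open>{..<d}\<close>.
  Vectors of length \<open>N\<^sup>2\<close> have the index type \<open>'k \<times> 'k\<close>, with \<open>(i, j)\<close> for position \<open>(i - 1) N + j\<close>.
\<close>

abbreviation tuples :: "nat \<Rightarrow> (nat \<Rightarrow> real) set" where
  "tuples m \<equiv> extensional {..<m}"

definition hurwitz :: "real ^ 'a ^ 'a \<Rightarrow> bool" where
  "hurwitz A \<longleftrightarrow>
     (\<forall>(c::complex) (v::complex ^ 'a). v \<noteq> 0 \<and> (\<chi> i j. complex_of_real (A $ i $ j)) *v v = c *s v \<longrightarrow> Re c < 0)"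

definition kron_vec :: "real ^ 'a \<Rightarrow> real ^ 'b \<Rightarrow> real ^ ('a \<times> 'b)" where
  "kron_vec u v = (\<chi> q. u $ fst q * v $ snd q)"

definition kron_mat :: "real ^ 'b ^ 'a \<Rightarrow> real ^ 'd ^ 'c \<Rightarrow> real ^ ('b \<times> 'd) ^ ('a \<times> 'c)" where
  "kron_mat X Y = (\<chi> q r. X $ fst q $ fst r * Y $ snd q $ snd r)"

definition outer :: "real ^ 'a \<Rightarrow> real ^ 'b \<Rightarrow> real ^ 'b ^ 'a" where
  "outer u v = (\<chi> i j. u $ i * v $ j)"

definition spectral_norm :: "real ^ 'b ^ 'a \<Rightarrow> real" where
  "spectral_norm X = onorm (\<lambda>v. X *v v)"

definition lyap_sol :: "real ^ 'a ^ 'a \<Rightarrow> real ^ 'a ^ 'a" where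
  "lyap_sol A = (THE P. transpose A ** P + P ** A = - mat 1)"

definition minimum :: "('a \<Rightarrow> real) \<Rightarrow> 'a set \<Rightarrow> real" where
  "minimum f S = (LEAST c. c \<in> f ` S)"

definition gauge_space :: "(real ^ ('k \<times> 'k) ^ 'k) set" where
  "gauge_space = {K. \<forall>w. K *v kron_vec w w = 0}"

definition gauge_dim :: "'k itself \<Rightarrow> nat" where
  "gauge_dim _ = CARD('k)\<^sup>2 * (CARD('k) - 1) div 2"

text \<open>
  The fixed data. \<open>g\<^sub>i\<close> is the monomial with exponents \<open>expo D i\<close>; \<open>fa D i\<close> and \<open>fb D i\<close> are the
  indices of the coordinates \<open>a\<^sub>i\<close> and \<open>b\<^sub>i\<close> of \<open>w\<close>; \<open>sv D i\<close> is \<open>s\<^sub>i\<close>; \<open>gb D\<close> lists the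
  gauge basis; \<open>fac D \<Lambda>\<close> is the factor \<open>P\<^sub>f\<close> of \<open>P(\<Lambda>)\<close>.
\<close>

record ('n, 'k) lift =
  ldim :: nat
  xi :: "'n \<Rightarrow> 'k"
  yi :: "nat \<Rightarrow> 'k"
  expo :: "nat \<Rightarrow> 'n \<Rightarrow> nat"
  fa :: "nat \<Rightarrow> 'k"
  fb :: "nat \<Rightarrow> 'k"
  A0 :: "real ^ 'k ^ 'k"
  H0 :: "real ^ ('k \<times> 'k) ^ 'k"
  sv :: "nat \<Rightarrow> real ^ ('k \<times> 'k)"
  gb :: "nat \<Rightarrow> real ^ ('k \<times> 'k) ^ 'k"
  fac :: "(nat \<Rightarrow> real) \<Rightarrow> real ^ 'k ^ 'k"

definition lift_monomial :: "('n::finite, 'k::finite) lift \<Rightarrow> nat \<Rightarrow> real ^ 'n \<Rightarrow> real" where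
  "lift_monomial D i x = (\<Prod>j\<in>UNIV. (x $ j) ^ expo D i j)"

definition Phi :: "('n::finite, 'k::finite) lift \<Rightarrow> real ^ 'n \<Rightarrow> real ^ 'k" where
  "Phi D x = (\<Sum>j\<in>UNIV. axis (xi D j) (x $ j)) + (\<Sum>i<ldim D. axis (yi D i) (lift_monomial D i x))"

definition inner_quadratic_lift :: "('n::finite, 'k::finite) lift \<Rightarrow> bool" where
  "inner_quadratic_lift D \<longleftrightarrow>
     inj (xi D) \<and> bij_betw (yi D) {..<ldim D} (- range (xi D)) \<and>
     (\<forall>i<ldim D. 2 \<le> (\<Sum>j\<in>UNIV. expo D i j)) \<and>
     (\<forall>i<ldim D. {fa D i, fb D i} \<subseteq> range (xi D) \<union> yi D ` {..<i}) \<and>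
     (\<forall>i<ldim D. \<forall>x. lift_monomial D i x = Phi D x $ fa D i * Phi D x $ fb D i)"

definition stabilizer :: "('n::finite, 'k::finite) lift \<Rightarrow> nat \<Rightarrow> real ^ 'k \<Rightarrow> real" where
  "stabilizer D i w = w $ yi D i - w $ fa D i * w $ fb D i"

definition F0 :: "('n::finite, 'k::finite) lift \<Rightarrow> real ^ 'k \<Rightarrow> real ^ 'k" where
  "F0 D w = A0 D *v w + H0 D *v kron_vec w w"

definition reference_extension :: "(real ^ 'n \<Rightarrow> real ^ 'n) \<Rightarrow> ('n::finite, 'k::finite) lift \<Rightarrow> bool" where
  "reference_extension p D \<longleftrightarrow> (\<forall>x. F0 D (Phi D x) = jacobian (Phi D) (at x) *v p x)"

definition FL :: "('n::finite, 'k::finite) lift \<Rightarrow> (nat \<Rightarrow> real) \<Rightarrow> real ^ 'k \<Rightarrow> real ^ 'k" where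
  "FL D \<Lambda> w = F0 D w - (\<Sum>i<ldim D. (\<Lambda> i * stabilizer D i w) *\<^sub>R axis (yi D i) 1)"

definition AL :: "('n::finite, 'k::finite) lift \<Rightarrow> (nat \<Rightarrow> real) \<Rightarrow> real ^ 'k ^ 'k" where
  "AL D \<Lambda> = A0 D - (\<Sum>i<ldim D. \<Lambda> i *\<^sub>R outer (axis (yi D i) 1) (axis (yi D i) 1))"

definition represents_products :: "('n::finite, 'k::finite) lift \<Rightarrow> bool" where
  "represents_products D \<longleftrightarrow> (\<forall>i<ldim D. \<forall>w. sv D i \<bullet> kron_vec w w = w $ fa D i * w $ fb D i)"

definition gauge_basis :: "('n::finite, 'k::finite) lift \<Rightarrow> bool" where
  "gauge_basis D \<longleftrightarrow>
     (let I = {..<gauge_dim TYPE('k)} in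
       inj_on (gb D) I \<and> independent (gb D ` I) \<and> span (gb D ` I) = gauge_space)"

definition HL :: "('n::finite, 'k::finite) lift \<Rightarrow> (nat \<Rightarrow> real) \<Rightarrow> (nat \<Rightarrow> real) \<Rightarrow> real ^ ('k \<times> 'k) ^ 'k" where
  "HL D \<Lambda> \<mu> = H0 D + (\<Sum>i<ldim D. \<Lambda> i *\<^sub>R outer (axis (yi D i) 1) (sv D i))
                 + (\<Sum>k<gauge_dim TYPE('k). \<mu> k *\<^sub>R gb D k)"

definition feasible :: "('n::finite, 'k::finite) lift \<Rightarrow> (nat \<Rightarrow> real) set" where
  "feasible D = {\<Lambda> \<in> tuples (ldim D). hurwitz (AL D \<Lambda>)}"

definition PL :: "('n::finite, 'k::finite) lift \<Rightarrow> (nat \<Rightarrow> real) \<Rightarrow> real ^ 'k ^ 'k" where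
  "PL D \<Lambda> = lyap_sol (AL D \<Lambda>)"

definition certificate_factors :: "('n::finite, 'k::finite) lift \<Rightarrow> bool" where
  "certificate_factors D \<longleftrightarrow> (\<forall>\<Lambda>\<in>feasible D. PL D \<Lambda> = transpose (fac D \<Lambda>) ** fac D \<Lambda>)"

definition block :: "real ^ ('k \<times> 'k) ^ 'k \<Rightarrow> 'k \<Rightarrow> real ^ 'k ^ 'k" where
  "block H i = (\<chi> r j. H $ r $ (i, j))"

definition GL :: "('n::finite, 'k::finite) lift \<Rightarrow> (nat \<Rightarrow> real) \<Rightarrow> (nat \<Rightarrow> real) \<Rightarrow> real ^ 'k ^ ('k \<times> 'k)" where
  "GL D \<Lambda> \<mu> =
     (\<chi> q. (transpose (block (HL D \<Lambda> \<mu>) (fst q)) ** PL D \<Lambda> + PL D \<Lambda> ** block (HL D \<Lambda> \<mu>) (fst q)) $ snd q)"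

definition JL :: "('n::finite, 'k::finite) lift \<Rightarrow> (nat \<Rightarrow> real) \<Rightarrow> (nat \<Rightarrow> real) \<Rightarrow> real ^ 'k ^ ('k \<times> 'k)" where
  "JL D \<Lambda> \<mu> = matrix_inv (kron_mat (transpose (fac D \<Lambda>)) (mat 1 :: real ^ 'k ^ 'k)) ** GL D \<Lambda> \<mu>"

definition phi :: "('n::finite, 'k::finite) lift \<Rightarrow> (nat \<Rightarrow> real) \<Rightarrow> real" where
  "phi D \<Lambda> = minimum (\<lambda>\<mu>. spectral_norm (JL D \<Lambda> \<mu>)) (tuples (gauge_dim TYPE('k)))"

text \<open>In \<^typ>\<open>ereal\<close>, \<open>1 / 0 = \<infinity>\<close>.\<close>

definition rho_star :: "('n::finite, 'k::finite) lift \<Rightarrow> (nat \<Rightarrow> real) \<Rightarrow> ereal" where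
  "rho_star D \<Lambda> = 1 / ereal (phi D \<Lambda>)"

definition gain_box :: "nat \<Rightarrow> (nat \<Rightarrow> real) set \<Rightarrow> bool" where
  "gain_box m B \<longleftrightarrow> B \<noteq> {} \<and> (\<exists>lo hi. B = (\<Pi>\<^sub>E i\<in>{..<m}. {lo i..hi i}))"

definition admissible_gain_box :: "('n::finite, 'k::finite) lift \<Rightarrow> (nat \<Rightarrow> real) set \<Rightarrow> bool" where
  "admissible_gain_box D B \<longleftrightarrow> gain_box (ldim D) B \<and> B \<subseteq> feasible D"

definition phi_box :: "('n::finite, 'k::finite) lift \<Rightarrow> (nat \<Rightarrow> real) set \<Rightarrow> real" where
  "phi_box D B = minimum (phi D) B"

definition pullback :: "('n::finite, 'k::finite) lift \<Rightarrow> (nat \<Rightarrow> real) \<Rightarrow> ereal \<Rightarrow> (real ^ 'n) set" where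
  "pullback D \<Lambda> \<rho> = {x. ereal (Phi D x \<bullet> (PL D \<Lambda> *v Phi D x)) \<le> \<rho>\<^sup>2}"

text \<open>\<^const>\<open>unit_ball_vol\<close> is \<open>\<kappa>\<^sub>n = \<pi>\<^bsup>n/2\<^esup> / \<Gamma>(n/2 + 1)\<close>.\<close>

definition volume_coeff :: "(real ^ 'n \<Rightarrow> real ^ 'n) \<Rightarrow> ('n::finite, 'k::finite) lift \<Rightarrow> (nat \<Rightarrow> real) \<Rightarrow> real" where
  "volume_coeff p D \<Lambda> =
     unit_ball_vol (real CARD('n)) * real_of_ereal (rho_star D \<Lambda>) ^ CARD('n)
       / sqrt (det (lyap_sol (jacobian p (at 0))))"

definition global_quadratic_lyapunov :: "real ^ 'k ^ 'k \<Rightarrow> (real ^ 'k \<Rightarrow> real ^ 'k) \<Rightarrow> bool" where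
  "global_quadratic_lyapunov P F \<longleftrightarrow>
     (let V = (\<lambda>w. w \<bullet> (P *v w)) in
       \<forall>w. w \<noteq> 0 \<longrightarrow> 0 < V w \<and> frechet_derivative V (at w) (F w) < 0)"

end

theory Submission
  imports Defs "HOL-Computational_Algebra.Fundamental_Theorem_Algebra"
begin

text \<open>
  Write \<open>P = P(\<Lambda>)\<close> and \<open>F = P\<^sub>f\<close>, so that \<open>P = F\<^sup>T F\<close> and \<open>w\<^sup>T P w = |F w|\<^sup>2\<close>.

  The Lyapunov equation. For a Hurwitz matrix \<open>A\<close> the operator \<open>X \<mapsto> A\<^sup>T X + X A\<close> is injective
  (\<open>sylvester_injective\<close>): its kernel is invariant under \<open>X \<mapsto> X A\<close>, and an eigenvector of this map
  in the kernel would give both \<open>c\<close> and \<open>-c\<close> as eigenvalues of \<open>A\<close>. So \<open>P\<close> is well defined and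
  continuous in \<open>\<Lambda>\<close>. It is positive definite, since \<open>F v = 0\<close> forces \<open>0 = v\<^sup>T (A\<^sup>T P + P A) v = -|v|\<^sup>2\<close>.

  The minima are attained. The factor \<open>F\<close> may depend on \<open>\<Lambda>\<close> in any way, but by duality
  \<open>\<parallel>(F\<^sup>T \<otimes> I)\<^sup>-\<^sup>1 G\<parallel> \<le> t\<close> means \<open>u \<bullet> G v \<le> t |v| (u \<bullet> (P \<otimes> I) u)\<^sup>1\<^sup>/\<^sup>2\<close> for all \<open>u\<close>, \<open>v\<close>, which
  involves \<open>P\<close> only. Left multiplication by \<open>P\<close> maps the gauge space onto itself, so as \<open>\<mu>\<close> varies,
  \<open>G(\<Lambda>, \<mu>)\<close> runs through a translate of one linear subspace \<open>W\<close>, the same for all \<open>\<Lambda>\<close>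
  (\<open>GL_gauge_orbit\<close>). Minimizing \<open>\<parallel>J(\<Lambda>, \<mu>)\<parallel>\<close> over \<open>B\<close> and all \<open>\<mu>\<close> is thus minimizing \<open>t\<close> over a
  compact set of triples \<open>(\<Lambda>, Z, t)\<close> with \<open>Z \<in> W\<close> (\<open>joint_minimum\<close>). Applied to \<open>B\<close> and to boxes
  that are single points, this shows that \<open>\<phi>\<^sub>B\<close> and \<open>\<phi>\<close> are attained. If \<open>\<phi>(\<Lambda>) = 0\<close>, then \<open>G(\<Lambda>, \<mu>) = 0\<close>
  for some \<open>\<mu>\<close>; this removes the cubic part \<open>2 w\<^sup>T P H(w \<otimes> w)\<close> of the derivative of \<open>w\<^sup>T P w\<close> and
  leaves \<open>-|w|\<^sup>2\<close> (\<open>zero_phi_imp_lyapunov\<close>).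

  The volumes. Near the origin \<open>\<Phi>(x) = (x, 0) + O(|x|\<^sup>2)\<close>, so \<open>|F \<Phi>(x)|\<close> agrees with \<open>|Q x|\<close> up to a
  factor tending to 1, where \<open>Q\<^sup>T Q\<close> is the leading block of \<open>P\<close>. The set \<open>{x. |F \<Phi>(x)| \<le> r}\<close>,
  which shrinks to the origin because \<open>|F \<Phi>(x)|\<close> dominates a multiple of \<open>|x|\<close>, is squeezed between
  two ellipsoids, and its volume is \<open>\<kappa>\<^sub>n r\<^sup>n / |det Q|\<close> up to a factor tending to 1
  (\<open>volume_sublevel_asymptotics\<close>). Comparing the linear parts at 0 of the two sides of
  \<open>F\<^sub>0(\<Phi>(x)) = J(\<Phi>)(x) p(x)\<close> shows that \<open>A(\<Lambda>)\<close> maps \<open>(x, 0)\<close> to \<open>(J\<^sub>p x, 0)\<close>; hence the leading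
  block of \<open>P\<close> solves the Lyapunov equation of \<open>J\<^sub>p\<close> (\<open>lyap_sol_leading_block\<close>). So \<open>det Q\<close> does
  not depend on \<open>\<Lambda>\<close> up to sign, and only the factor \<open>\<rho>\<^sup>\<star>(\<Lambda>)\<^sup>n\<close> of the leading coefficient ranks the gains.
\<close>

section \<open>Eigenvectors and the Lyapunov equation\<close>

text \<open>
  More than \<open>DIM\<close> vectors are dependent; a repetition among the iterates is a dependence as well. Real
  coefficients suffice because the dimension is counted over the reals.
\<close>

lemma annihilating_combination:
  fixes T :: "complex ^ 'n \<Rightarrow> complex ^ 'n"
  shows "\<exists>(N::nat) u :: nat \<Rightarrow> real. (\<exists>i\<le>N. u i \<noteq> 0) \<and> (\<Sum>i\<le>N. u i *\<^sub>R (T ^^ i) x) = 0"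
proof (cases "inj_on (\<lambda>i. (T ^^ i) x) {..DIM(complex ^ 'n)}")
  case True
  let ?f = "\<lambda>i. (T ^^ i) x" and ?N = "DIM(complex ^ 'n)"
  have "dependent (?f ` {..?N})"
    by (rule dependent_biggerset) (simp only: card_image[OF True], simp)
  then obtain u where u: "\<exists>v\<in>?f ` {..?N}. u v \<noteq> 0" "(\<Sum>v\<in>?f ` {..?N}. u v *\<^sub>R v) = 0"
    using dependent_finite[of "?f ` {..?N}"] by auto
  have "(\<Sum>i\<le>?N. u (?f i) *\<^sub>R ?f i) = 0"
    using u(2) unfolding sum.reindex[OF True] comp_def .
  then show ?thesis using u(1) by (intro exI[of _ ?N] exI[of _ "u \<circ> ?f"]) auto
next
  case False
  then obtain i j where ij: "i \<le> DIM(complex ^ 'n)" "j \<le> DIM(complex ^ 'n)" "i \<noteq> j" "(T ^^ i) x = (T ^^ j) x"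
    by (auto simp: inj_on_def)
  let ?u = "\<lambda>k. (if k = i then 1 else 0) - (if k = j then (1::real) else 0)"
  have "(\<Sum>k\<le>DIM(complex ^ 'n). ?u k *\<^sub>R (T ^^ k) x) = (T ^^ i) x - (T ^^ j) x"
    using ij(1,2) by (simp add: scaleR_diff_left sum_subtractf if_distrib[of "\<lambda>r. r *\<^sub>R _"] sum.delta cong: if_cong)
  then show ?thesis using ij by (intro exI[of _ "DIM(complex ^ 'n)"] exI[of _ ?u]) auto
qed

text \<open>
  The polynomials \<open>q\<close> with \<open>q(T) x = 0\<close> contain a nonzero one of least degree. Splitting off a root \<open>c\<close>
  as \<open>q = (X - c) r\<close>, minimality gives \<open>r(T) x \<noteq> 0\<close>, and this vector is an eigenvector. It lies in
  every invariant subspace that contains \<open>x\<close>.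
\<close>

lemma eigenvector_exists:
  fixes T :: "complex ^ 'n \<Rightarrow> complex ^ 'n"
  assumes add: "\<And>x y. T (x + y) = T x + T y" and scale: "\<And>c x. T (c *s x) = c *s T x"
    and S_add: "\<And>x y. x \<in> S \<Longrightarrow> y \<in> S \<Longrightarrow> x + y \<in> S" and S_scale: "\<And>c x. x \<in> S \<Longrightarrow> c *s x \<in> S"
    and S_inv: "\<And>x. x \<in> S \<Longrightarrow> T x \<in> S" and x: "x \<in> S" "x \<noteq> 0"
  shows "\<exists>c v. v \<in> S \<and> v \<noteq> 0 \<and> T v = c *s v"
proof -
  define ev where "ev q = fold_coeffs (\<lambda>a v. a *s x + T v) q 0" for q
  have T0: "T 0 = 0" using add[of 0 0] by simp
  have ev0: "ev 0 = 0" by (simp add: ev_def)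
  have evC: "ev (pCons a q) = a *s x + T (ev q)" for a q
    by (cases "a = 0 \<and> q = 0") (auto simp: ev_def T0)
  have ev_add: "ev (p + q) = ev p + ev q" for p q
    by (induction p q rule: poly_induct2) (auto simp: ev0 evC add vector_sadd_rdistrib)
  have ev_smult: "ev (smult c p) = c *s ev p" for c p
    by (induction p rule: pCons_induct) (auto simp: ev0 evC scale vector_add_ldistrib)
  have ev_S: "ev p \<in> S" for p
    using S_scale[OF x(1), of 0]
    by (induction p rule: pCons_induct) (auto simp: ev0 evC intro!: S_add S_scale S_inv x)
  have ev_monom: "ev (monom a i) = a *s (T ^^ i) x" for a i
    by (induction i) (auto simp: monom_0 monom_Suc evC ev0 T0 scale)
  obtain N u where u: "\<exists>i\<le>N. u i \<noteq> (0::real)" "(\<Sum>i\<le>N. u i *\<^sub>R (T ^^ i) x) = 0"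
    using annihilating_combination[of T x] by blast
  define q0 where "q0 = (\<Sum>i\<le>N. monom (complex_of_real (u i)) i)"
  have ev_sum: "ev (\<Sum>i\<in>I. f i) = (\<Sum>i\<in>I. ev (f i))" if "finite I" for I :: "nat set" and f
    using that by induction (auto simp: ev0 ev_add)
  have "ev q0 = 0"
    using u(2) by (simp add: q0_def ev_sum ev_monom scaleR_vec_def vector_scalar_mult_def scaleR_conv_of_real)
  moreover have "q0 \<noteq> 0"
  proof
    assume "q0 = 0"
    moreover have "coeff q0 i = (if i \<le> N then complex_of_real (u i) else 0)" for i
      by (simp add: q0_def coeff_sum sum.delta cong: if_cong)
    ultimately have "u i = 0" if "i \<le> N" for i
      using that by (metis coeff_0 of_real_eq_0_iff)
    then show False using u(1) by auto
  qed
  ultimately have "\<exists>q. q \<noteq> 0 \<and> ev q = 0" by blast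
  then obtain q where q: "q \<noteq> 0" "ev q = 0" and least: "\<And>r. r \<noteq> 0 \<and> ev r = 0 \<Longrightarrow> degree q \<le> degree r"
    using ex_has_least_nat[of "\<lambda>q. q \<noteq> 0 \<and> ev q = 0" _ degree] by metis
  have "degree q \<noteq> 0"
  proof
    assume "degree q = 0"
    then obtain a where "q = [:a:]" by (auto elim: degree_eq_zeroE)
    then show False using q x(2) by (auto simp: evC ev0 T0)
  qed
  then have "\<not> constant (poly q)" by (simp add: constant_degree)
  then obtain c where "poly q c = 0" using fundamental_theorem_of_algebra by blast
  then obtain r where r: "q = [:- c, 1:] * r" by (metis poly_eq_0_iff_dvd dvdE)
  then have "r \<noteq> 0" using q by auto
  then have "degree q = Suc (degree r)" unfolding r by (subst degree_mult_eq) auto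
  then have "ev r \<noteq> 0" using least[of r] \<open>r \<noteq> 0\<close> by auto
  moreover have "T (ev r) = c *s ev r"
  proof -
    have "q = pCons 0 r + smult (- c) r" by (simp add: r)
    then have "0 = T (ev r) + (- c) *s ev r" using q(2) by (simp only: ev_add ev_smult evC) simp
    then show ?thesis by (simp add: vec_eq_iff)
  qed
  ultimately show ?thesis using ev_S by blast
qed

text \<open>
  A square matrix and its transpose are singular together, so left eigenvalues are right eigenvalues.
\<close>

lemma hurwitz_left_eigenvalue:
  fixes A :: "real ^ 'a ^ 'a"
  assumes "hurwitz A" "v \<noteq> 0" and eq: "v v* (\<chi> i j. complex_of_real (A $ i $ j)) = c *s v"
  shows "Re c < 0"
proof -
  let ?A = "\<chi> i j. complex_of_real (A $ i $ j)"
  let ?M = "?A - mat c"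
  have "v v* ?M = v v* ?A - c *s v"
    by (simp add: vec_eq_iff vector_matrix_mult_def mat_def right_diff_distrib sum_subtractf left_diff_distrib
        if_distrib[of "\<lambda>x. _ * x"] mult.commute sum.delta cong: if_cong)
  then have "v v* ?M = 0" using eq by simp
  then have "transpose ?M *v v = 0" by simp
  then have "\<not> invertible (transpose ?M)"
    using \<open>v \<noteq> 0\<close> by (metis invertible_left_inverse matrix_left_invertible_ker)
  then have "\<not> invertible ?M" by (simp add: invertible_det_nz)
  then obtain w where w: "w \<noteq> 0" "?M *v w = 0"
    by (metis invertible_left_inverse matrix_left_invertible_ker)
  have "?M *v w = ?A *v w - c *s w"
    by (simp add: vec_eq_iff matrix_vector_mult_def mat_def left_diff_distrib sum_subtractf
        if_distrib[of "\<lambda>x. x * _"] sum.delta cong: if_cong)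
  then have "?A *v w = c *s w" using w(2) by simp
  then show ?thesis using \<open>hurwitz A\<close> w(1) unfolding hurwitz_def by blast
qed

text \<open>
  The kernel of \<open>X \<mapsto> A\<^sup>T X + X A\<close> is invariant under \<open>X \<mapsto> X A\<close>, as this map commutes with the
  operator. If the kernel were nonzero, it would contain a complex eigenvector \<open>Y\<close>, with \<open>Y A = c Y\<close> and
  therefore \<open>A\<^sup>T Y = - c Y\<close>. A nonzero row of \<open>Y\<close> then has eigenvalue \<open>c\<close> and a nonzero column
  eigenvalue \<open>-c\<close>, and both cannot have negative real part. Matrices are encoded as vectors indexed
  by pairs, so that \<open>eigenvector_exists\<close> applies.
\<close>

lemma sylvester_injective:
  fixes A X :: "real ^ 'a ^ 'a"
  assumes A: "hurwitz A" and X: "transpose A ** X + X ** A = 0"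
  shows "X = 0"
proof (rule ccontr)
  assume "X \<noteq> 0"
  let ?a = "\<lambda>i j. complex_of_real (A $ i $ j)"
  \<comment> \<open>\<open>T\<close> is \<open>Y \<mapsto> Y A\<close>, and \<open>S\<close> is the complexified kernel.\<close>
  define T :: "complex ^ ('a \<times> 'a) \<Rightarrow> complex ^ ('a \<times> 'a)"
    where "T Y = (\<chi> q. \<Sum>k\<in>UNIV. Y $ (fst q, k) * ?a k (snd q))" for Y
  define S where "S = {Y. \<forall>q. (\<Sum>k\<in>UNIV. ?a k (fst q) * Y $ (k, snd q)) = - T Y $ q}"
  define Y0 :: "complex ^ ('a \<times> 'a)" where "Y0 = (\<chi> q. complex_of_real (X $ fst q $ snd q))"
  have "\<exists>c v. v \<in> S \<and> v \<noteq> 0 \<and> T v = c *s v"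
  proof (rule eigenvector_exists)
    show "T (x + y) = T x + T y" for x y
      by (simp add: T_def vec_eq_iff sum.distrib algebra_simps)
    show "T (c *s x) = c *s T x" for c x
      by (simp add: T_def vec_eq_iff sum_distrib_left mult.assoc)
    show "Y0 \<noteq> 0" using \<open>X \<noteq> 0\<close> by (auto simp: Y0_def vec_eq_iff)
    show "Y0 \<in> S"
    proof -
      have "(transpose A ** X + X ** A) $ i $ j = 0" for i j using X by simp
      then have "complex_of_real (\<Sum>k\<in>UNIV. A $ k $ i * X $ k $ j) + complex_of_real (\<Sum>k\<in>UNIV. X $ i $ k * A $ k $ j) = 0" for i j
        by (simp add: matrix_matrix_mult_def transpose_def flip: of_real_add del: of_real_sum)
      then show ?thesis
        by (simp add: S_def T_def Y0_def eq_neg_iff_add_eq_0)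
    qed
    show "x + y \<in> S" if "x \<in> S" "y \<in> S" for x y
      using that by (simp add: S_def T_def sum.distrib algebra_simps)
    show "c *s x \<in> S" if "x \<in> S" for c x
      using that by (simp add: S_def T_def algebra_simps flip: sum_distrib_left)
    show "T Y \<in> S" if "Y \<in> S" for Y
    proof -
      have *: "(\<Sum>k\<in>UNIV. ?a k i * Y $ (k, l)) = - T Y $ (i, l)" for i l
        using that by (simp add: S_def)
      have "(\<Sum>k\<in>UNIV. ?a k (fst q) * T Y $ (k, snd q)) = - T (T Y) $ q" for q
      proof -
        have "(\<Sum>k\<in>UNIV. ?a k (fst q) * T Y $ (k, snd q))
            = (\<Sum>k\<in>UNIV. \<Sum>l\<in>UNIV. ?a k (fst q) * (Y $ (k, l) * ?a l (snd q)))"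
          by (simp add: T_def sum_distrib_left)
        also have "\<dots> = (\<Sum>l\<in>UNIV. (\<Sum>k\<in>UNIV. ?a k (fst q) * Y $ (k, l)) * ?a l (snd q))"
          by (subst sum.swap) (simp add: sum_distrib_right mult.assoc)
        also have "\<dots> = (\<Sum>l\<in>UNIV. - T Y $ (fst q, l) * ?a l (snd q))" by (simp add: *)
        also have "\<dots> = - T (T Y) $ q"
          by (subst (2) T_def) (simp add: sum_negf)
        finally show ?thesis .
      qed
      then show ?thesis unfolding S_def by blast
    qed
  qed
  then obtain c Y where Y: "Y \<in> S" "Y \<noteq> 0" "T Y = c *s Y" by blast
  have left: "(\<Sum>k\<in>UNIV. ?a k i * Y $ (k, j)) = - c * Y $ (i, j)" for i j
    using Y(1,3) by (simp add: S_def)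
  have right: "(\<Sum>k\<in>UNIV. Y $ (i, k) * ?a k j) = c * Y $ (i, j)" for i j
    using Y(3) by (simp add: T_def vec_eq_iff)
  obtain i0 j0 where ne: "Y $ (i0, j0) \<noteq> 0" using Y(2) by (auto simp: vec_eq_iff)
  have "Re c < 0"
  proof (rule hurwitz_left_eigenvalue[OF A])
    show "(\<chi> j. Y $ (i0, j)) \<noteq> 0" using ne by (auto simp: vec_eq_iff)
    show "(\<chi> j. Y $ (i0, j)) v* (\<chi> i j. ?a i j) = c *s (\<chi> j. Y $ (i0, j))"
      using right[of i0] by (simp add: vec_eq_iff vector_matrix_mult_def mult.commute)
  qed
  moreover have "Re (- c) < 0"
  proof (rule hurwitz_left_eigenvalue[OF A])
    show "(\<chi> i. Y $ (i, j0)) \<noteq> 0" using ne by (auto simp: vec_eq_iff)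
    show "(\<chi> i. Y $ (i, j0)) v* (\<chi> i j. ?a i j) = (- c) *s (\<chi> i. Y $ (i, j0))"
      using left[of _ j0] by (simp add: vec_eq_iff vector_matrix_mult_def mult.commute)
  qed
  ultimately show False by simp
qed

lemma bilinear_lyapunov:
  "bilinear (\<lambda>(A :: real ^ 'a ^ 'a) (X :: real ^ 'a ^ 'a). transpose A ** X + X ** A)"
  unfolding bilinear_def
  by (auto intro!: linearI simp: vec_eq_iff matrix_matrix_mult_def transpose_def
      sum.distrib sum_distrib_left algebra_simps)

lemma lyap_sol_unique:
  fixes A P :: "real ^ 'a ^ 'a"
  assumes "hurwitz A" "transpose A ** P + P ** A = - mat 1"
  shows "lyap_sol A = P"
  unfolding lyap_sol_def
proof (rule the_equality)
  fix Q assume "transpose A ** Q + Q ** A = - mat 1"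
  then have "transpose A ** (Q - P) + (Q - P) ** A = 0"
    using assms(2) bilinear_rsub[OF bilinear_lyapunov, of A Q P] by simp
  from sylvester_injective[OF assms(1) this] show "Q = P" by simp
qed fact

lemma lyap_sol_equation:
  fixes A :: "real ^ 'a ^ 'a"
  assumes "hurwitz A"
  shows "transpose A ** lyap_sol A + lyap_sol A ** A = - mat 1"
proof -
  let ?L = "\<lambda>X :: real ^ 'a ^ 'a. transpose A ** X + X ** A"
  have lin: "linear ?L" using bilinear_lyapunov unfolding bilinear_def by blast
  have "inj ?L"
    unfolding linear_injective_0[OF lin] by (intro allI impI, rule sylvester_injective[OF assms])
  then have "surj ?L" using linear_injective_imp_surjective[OF lin] by simp
  then obtain P where "- mat 1 = ?L P" by (rule surjE)
  from this[symmetric] show ?thesis by (simp only: lyap_sol_unique[OF assms])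
qed

text \<open>
  Write \<open>L\<^sub>A\<close> for the operator. From \<open>L\<^sub>A P = L\<^sub>A\<^sub>' P' = - I\<close> one gets \<open>L\<^sub>A (P' - P) = L\<^bsub>A - A'\<^esub> P'\<close>. The left side
  is at least \<open>b |P' - P|\<close> by injectivity and the right side at most \<open>K |A - A'| |P'|\<close>, which is small
  together with \<open>A - A'\<close> once the part of \<open>P'\<close> coming from \<open>P' - P\<close> is absorbed on the left.
\<close>

lemma continuous_on_lyap_sol: "continuous_on {A :: real ^ 'a ^ 'a. hurwitz A} lyap_sol"
  unfolding continuous_on_iff
proof (intro ballI allI impI)
  fix A :: "real ^ 'a ^ 'a" and e :: real
  assume "A \<in> {A. hurwitz A}" and "e > 0"
  then have A: "hurwitz A" by simp
  define L where "L = (\<lambda>(A :: real ^ 'a ^ 'a) (X :: real ^ 'a ^ 'a). transpose A ** X + X ** A)"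
  have bil: "bilinear L" using bilinear_lyapunov by (simp add: L_def)
  obtain K where K: "K > 0" "\<And>A X. norm (L A X) \<le> K * norm A * norm X"
    using bilinear_bounded_pos[OF bil] by blast
  have lin: "linear (L A)" using bil by (simp add: bilinear_def)
  have "inj (L A)"
    unfolding linear_injective_0[OF lin] unfolding L_def by (intro allI impI, rule sylvester_injective[OF A])
  then obtain b where b: "b > 0" "\<And>X. b * norm X \<le> norm (L A X)"
    using linear_inj_bounded_below_pos[OF lin] by metis
  define P where "P = lyap_sol A"
  \<comment> \<open>The first bound lets \<open>P' - P\<close> be absorbed, the second makes what remains smaller than \<open>e\<close>.\<close>
  define d where "d = min (b / (2 * K)) (e * b / (4 * K * (norm P + 1)))"
  have "d > 0" using b K \<open>e > 0\<close> by (simp add: d_def add_nonneg_pos)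
  moreover have "dist (lyap_sol A') (lyap_sol A) < e" if A': "hurwitz A'" and dA: "dist A' A < d" for A'
  proof -
    define P' where "P' = lyap_sol A'"
    have "L A' P' = - mat 1" "L A P = - mat 1"
      using lyap_sol_equation[OF A] lyap_sol_equation[OF A'] by (auto simp: L_def P_def P'_def)
    then have "L A (P' - P) = L (A - A') P'"
      using bil by (simp add: bilinear_lsub bilinear_rsub)
    then have "b * norm (P' - P) \<le> K * norm (A - A') * norm P'"
      using b(2)[of "P' - P"] K(2)[of "A - A'" P'] by simp
    also have "\<dots> \<le> K * norm (A - A') * (norm (P' - P) + norm P)"
      using K(1) norm_triangle_sub[of P' P] by (intro mult_left_mono) (auto simp: add.commute)
    also have "\<dots> \<le> b / 2 * norm (P' - P) + K * norm (A - A') * norm P"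
    proof -
      have "norm (A - A') \<le> b / (2 * K)" using dA by (simp add: d_def dist_norm norm_minus_commute)
      then have "K * norm (A - A') \<le> b / 2" using K(1) by (simp add: field_simps)
      then have "K * norm (A - A') * norm (P' - P) \<le> b / 2 * norm (P' - P)" by (intro mult_right_mono) auto
      then show ?thesis by (simp add: algebra_simps)
    qed
    finally have "b * norm (P' - P) \<le> 2 * (K * norm (A - A') * norm P)" by simp
    also have "\<dots> \<le> 2 * (K * (e * b / (4 * K * (norm P + 1))) * norm P)"
      using dA K(1) by (intro mult_left_mono mult_right_mono) (auto simp: d_def dist_norm norm_minus_commute)
    also have "\<dots> = e * b / 2 * (norm P / (norm P + 1))"
    proof -
      have "2 * (K * (e * b / (4 * K * p)) * norm P) = e * b / 2 * (norm P / p)" for p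
        using K(1) by simp
      then show ?thesis .
    qed
    also have "\<dots> \<le> e * b / 2 * 1"
      using b(1) \<open>e > 0\<close> by (intro mult_left_mono) (auto simp: divide_le_eq_1 add_nonneg_pos)
    also have "\<dots> < e * b" using b(1) \<open>e > 0\<close> by simp
    finally show ?thesis using b(1) by (simp add: dist_norm P_def P'_def mult.commute)
  qed
  ultimately show "\<exists>d>0. \<forall>A'\<in>{A. hurwitz A}. dist A' A < d \<longrightarrow> dist (lyap_sol A') (lyap_sol A) < e"
    by blast
qed

section \<open>Volumes of linear images and of sublevel sets\<close>

lemma det_shear:
  fixes m n :: "'n::finite"
  assumes "m \<noteq> n"
  shows "det (matrix (\<lambda>v :: real ^ 'n. \<chi> i. if i = m then v $ m + v $ n else v $ i)) = 1"
proof -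
  have "matrix (\<lambda>v :: real ^ 'n. \<chi> i. if i = m then v $ m + v $ n else v $ i)
      = (\<chi> k. if k = m then row m (mat 1) + 1 *s row n (mat 1) else row k (mat 1))"
    by (auto simp: matrix_def row_def mat_def axis_def vec_eq_iff)
  then show ?thesis by (simp only: det_row_operation[OF assms] det_I)
qed

lemma content_shear:
  fixes m n :: "'n::finite" and a b :: "real ^ 'n"
  assumes "m \<noteq> n"
  shows "measure lebesgue ((\<lambda>v. \<chi> i. if i = m then v $ m + v $ n else v $ i) ` cbox a b)
       = measure lebesgue (cbox a b)"
proof (cases "cbox a b = {}")
  case False
  let ?h = "\<lambda>v :: real ^ 'n. \<chi> i. if i = m then v $ m + v $ n else v $ i"
  have lin: "linear ?h" by (rule linearI) (auto simp: vec_eq_iff algebra_simps)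
  \<comment> \<open>Moving the corner \<open>a\<close> to the origin makes the \<open>n\<close>-th coordinates nonnegative.\<close>
  have "cbox a b = (+) a ` cbox 0 (b - a)" using cbox_translation[of a 0 "b - a"] by simp
  then have "?h ` cbox a b = (+) (?h a) ` ?h ` cbox 0 (b - a)"
    by (simp add: image_comp o_def linear_add[OF lin])
  then have "measure lebesgue (?h ` cbox a b) = measure lebesgue (?h ` cbox 0 (b - a))"
    by (simp add: measure_translation)
  also have "\<dots> = measure lebesgue (cbox 0 (b - a))"
    using False assms \<open>cbox a b = _\<close> by (intro measure_shear_interval) auto
  also have "\<dots> = measure lebesgue (cbox a b)"
    unfolding \<open>cbox a b = _\<close> by (simp only: measure_translation)
  finally show ?thesis .
qed auto

lemma content_swap:
  fixes m n :: "'n::finite" and a b :: "real ^ 'n"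
  shows "measure lebesgue ((\<lambda>v. \<chi> i. v $ Transposition.transpose m n i) ` cbox a b)
       = measure lebesgue (cbox a b)"
proof (cases "cbox a b = {}")
  case False
  let ?t = "Transposition.transpose m n"
  let ?h = "\<lambda>v :: real ^ 'n. \<chi> i. v $ ?t i"
  have tt: "?t (?t i) = i" for i by simp
  have "?h ` cbox a b = cbox (?h a) (?h b)"
  proof (intro set_eqI iffI)
    fix x assume "x \<in> cbox (?h a) (?h b)"
    then have "a $ i \<le> x $ ?t i \<and> x $ ?t i \<le> b $ i" for i
      by (metis mem_box_cart(2) tt vec_lambda_beta)
    then have "?h x \<in> cbox a b" by (simp add: mem_box_cart)
    moreover have "x = ?h (?h x)" by (simp add: vec_eq_iff)
    ultimately show "x \<in> ?h ` cbox a b" by blast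
  qed (auto simp: mem_box_cart)
  moreover have "cbox (?h a) (?h b) \<noteq> {}" using False calculation by auto
  moreover have "(\<Prod>i\<in>UNIV. b $ ?t i - a $ ?t i) = (\<Prod>i\<in>UNIV. b $ i - a $ i)"
    using prod.permute[OF permutes_swap_id, where S = UNIV and g = "\<lambda>i. b $ i - a $ i"] by (simp add: o_def)
  ultimately show ?thesis using False by (simp add: content_cbox_cart)
qed auto

lemma abs_det_swap:
  fixes m n :: "'n::finite"
  shows "\<bar>det (matrix (\<lambda>v :: real ^ 'n. \<chi> i. v $ Transposition.transpose m n i))\<bar> = 1"
proof -
  have "matrix (\<lambda>v :: real ^ 'n. \<chi> i. v $ Transposition.transpose m n i)
      = (\<chi> i. mat 1 $ Transposition.transpose m n i)"
    by (auto simp: matrix_def mat_def axis_def vec_eq_iff)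
  then show ?thesis
    by (simp add: det_permute_rows permutes_swap_id sign_swap_id abs_mult)
qed

text \<open>
  The factor \<open>|det f|\<close> is multiplicative under composition, and every linear map is composed of maps with
  a vanishing coordinate, dilations of the axes, swaps and shears.
\<close>

lemma measure_linear_image_cart:
  fixes f :: "real ^ 'n \<Rightarrow> real ^ 'n"
  assumes "linear f" "S \<in> lmeasurable"
  shows "measure lebesgue (f ` S) = \<bar>det (matrix f)\<bar> * measure lebesgue S"
proof -
  let ?P = "\<lambda>f :: real ^ 'n \<Rightarrow> real ^ 'n. \<forall>S\<in>lmeasurable. f ` S \<in> lmeasurable \<and>
              measure lebesgue (f ` S) = \<bar>det (matrix f)\<bar> * measure lebesgue S"
  have boxes: "?P f" if "linear f" "\<And>a b. measure lebesgue (f ` cbox a b) = \<bar>det (matrix f)\<bar> * measure lebesgue (cbox a b)"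
    for f :: "real ^ 'n \<Rightarrow> real ^ 'n"
    using measure_linear_sufficient[OF that(1) _ that(2)] by metis
  have "?P f"
  proof (rule induct_linear_elementary[OF assms(1)])
    fix f g :: "real ^ 'n \<Rightarrow> real ^ 'n" assume "linear f" "linear g" "?P f" "?P g"
    then show "?P (f \<circ> g)"
      using matrix_compose[OF \<open>linear g\<close> \<open>linear f\<close>] by (simp add: det_mul abs_mult image_comp[symmetric] del: o_apply comp_apply)
  next
    fix f :: "real ^ 'n \<Rightarrow> real ^ 'n" and i assume f: "linear f" "\<And>x. f x $ i = 0"
    then have "\<not> surj f" by (metis one_neq_zero surjD vec_component)
    then have "\<not> inj f" using f(1) linear_injective_imp_surjective by blast
    then have "det (matrix f) = 0" "negligible (f ` S)" for S
      using f(1) det_nz_iff_inj negligible_linear_singular_image by blast+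
    then show "?P f" by (simp add: negligible_iff_measure)
  next
    fix c
    show "?P (\<lambda>x. \<chi> i. c i * x $ i)"
      by (auto simp: measurable_stretch measure_stretch matrix_def axis_def det_diagonal)
  next
    fix m n :: 'n
    show "?P (\<lambda>x. \<chi> i. x $ Transposition.transpose m n i)"
      by (rule boxes) (auto simp: content_swap abs_det_swap vec_eq_iff intro!: linearI)
    assume "m \<noteq> n"
    then show "?P (\<lambda>x. \<chi> i. if i = m then x $ m + x $ n else x $ i)"
      by (intro boxes) (auto simp: content_shear det_shear vec_eq_iff algebra_simps intro!: linearI)
  qed
  then show ?thesis using assms(2) by blast
qed

lemma measure_ellipsoid:
  fixes Q :: "real ^ 'n ^ 'n"
  assumes "invertible Q" "r \<ge> 0"
  shows "{x. norm (Q *v x) \<le> r} \<in> lmeasurable"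
    and "measure lebesgue {x. norm (Q *v x) \<le> r}
           = unit_ball_vol (real CARD('n)) / \<bar>det Q\<bar> * r ^ CARD('n)"
proof -
  let ?E = "{x. norm (Q *v x) \<le> r}"
  have lin: "linear ((*v) Q)" by simp
  have inj: "inj ((*v) Q)" using assms(1) by (simp add: inj_matrix_vector_mult)
  obtain b where b: "b > 0" "\<And>x. b * norm x \<le> norm (Q *v x)"
    using linear_inj_bounded_below_pos[OF lin inj] by metis
  have "closed ?E" by (intro closed_Collect_le continuous_intros)
  moreover have "?E \<subseteq> cball 0 (r / b)"
    using b(1) order_trans[OF b(2)] by (auto simp: field_simps)
  ultimately have "compact ?E"
    using bounded_subset[OF bounded_cball] compact_eq_bounded_closed by blast
  then show meas: "?E \<in> lmeasurable" by (rule lmeasurable_compact)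
  have "surj ((*v) Q)" using linear_injective_imp_surjective[OF lin inj] by simp
  then have "(*v) Q ` ?E = cball 0 r" by (auto simp: image_iff surj_def) metis
  then have "measure lebesgue (cball 0 r :: (real ^ 'n) set) = \<bar>det Q\<bar> * measure lebesgue ?E"
    using measure_linear_image_cart[OF lin meas] by simp
  moreover have "measure lebesgue (cball 0 r :: (real ^ 'n) set) = unit_ball_vol (real CARD('n)) * r ^ CARD('n)"
    using content_cball[OF assms(2), of "0 :: real ^ 'n"] by simp
  ultimately show "measure lebesgue ?E = unit_ball_vol (real CARD('n)) / \<bar>det Q\<bar> * r ^ CARD('n)"
    using assms(1) by (simp add: invertible_det_nz field_simps)
qed

text \<open>
  For every \<open>e \<in> (0, 1)\<close> and all small \<open>r\<close>, the sublevel set lies between the ellipsoids \<open>|Q x| \<le> r / (1 + e)\<close>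
  and \<open>|Q x| \<le> r / (1 - e)\<close>. The lower bound \<open>c |x| \<le> |f x|\<close> keeps the sublevel set in the ball where
  the comparison of \<open>|f x|\<close> with \<open>|Q x|\<close> holds.
\<close>

lemma volume_sublevel_asymptotics:
  fixes f :: "real ^ 'n \<Rightarrow> 'b::real_normed_vector" and Q :: "real ^ 'n ^ 'n"
  assumes f: "continuous_on UNIV f" and c: "c > 0" "\<And>x. c * norm x \<le> norm (f x)"
    and Q: "invertible Q"
    and asym: "\<And>e. e > 0 \<Longrightarrow> \<exists>d>0. \<forall>x. norm x < d \<longrightarrow> \<bar>norm (f x) - norm (Q *v x)\<bar> \<le> e * norm (Q *v x)"
  shows "((\<lambda>r. measure lebesgue {x. norm (f x) \<le> r} / r ^ CARD('n))
            \<longlongrightarrow> unit_ball_vol (real CARD('n)) / \<bar>det Q\<bar>) (at_right 0)"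
proof -
  let ?n = "CARD('n)" and ?S = "\<lambda>r. {x. norm (f x) \<le> r}" and ?E = "\<lambda>r. {x. norm (Q *v x) \<le> r}"
  define V where "V = unit_ball_vol (real CARD('n)) / \<bar>det Q\<bar>"
  obtain b where b: "b > 0" "\<And>x. b * norm x \<le> norm (Q *v x)"
    using linear_inj_bounded_below_pos[OF matrix_vector_mul_linear inj_matrix_vector_mult[OF Q]] by blast
  have S: "?S r \<in> lmeasurable" for r
  proof -
    have "closed (?S r)" by (intro closed_Collect_le continuous_intros f)
    moreover have "?S r \<subseteq> cball 0 (r / c)"
      using c(1) order_trans[OF c(2)] by (auto simp: field_simps)
    ultimately show ?thesis
      using bounded_subset[OF bounded_cball] compact_eq_bounded_closed lmeasurable_compact by blast
  qed
  have squeeze: "\<forall>\<^sub>F r in at_right 0. V / (1 + e) ^ ?n \<le> measure lebesgue (?S r) / r ^ ?n \<and>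
      measure lebesgue (?S r) / r ^ ?n \<le> V / (1 - e) ^ ?n" if e: "0 < e" "e < 1" for e
  proof -
    obtain d where d: "d > 0" "\<And>x. norm x < d \<Longrightarrow> \<bar>norm (f x) - norm (Q *v x)\<bar> \<le> e * norm (Q *v x)"
      using asym[OF e(1)] by blast
    have "\<forall>\<^sub>F r in at_right (0::real). 0 < r \<and> r < min b c * d"
      using eventually_at_right_real[of 0 "min b c * d"] b(1) c(1) d(1) by (auto elim: eventually_mono)
    then show ?thesis
    proof eventually_elim
      case (elim r)
      then have r: "r > 0" "r < b * d" "r < c * d"
        using d(1) mult_right_mono[of "min b c" b d] mult_right_mono[of "min b c" c d]
        by (auto intro: less_le_trans simp del: mult_le_cancel_right mult_le_cancel_right_pos)
      have "?E (r / (1 + e)) \<subseteq> ?S r"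
      proof clarify
        fix x assume x: "norm (Q *v x) \<le> r / (1 + e)"
        also have "\<dots> \<le> r" using e r(1) by (simp add: field_simps)
        finally have "b * norm x < b * d" using b(2)[of x] r(2) by simp
        then have "norm x < d" using b(1) by simp
        then have "norm (f x) \<le> (1 + e) * norm (Q *v x)" using d(2)[of x] by (simp add: algebra_simps)
        also have "\<dots> \<le> (1 + e) * (r / (1 + e))" using x e by (intro mult_left_mono) auto
        finally show "norm (f x) \<le> r" using e by simp
      qed
      then have 1: "measure lebesgue (?E (r / (1 + e))) \<le> measure lebesgue (?S r)"
        using e r(1) S measure_ellipsoid(1)[OF Q, of "r / (1 + e)"]
        by (intro measure_mono_fmeasurable) (auto simp: fmeasurableD)
      have "?S r \<subseteq> ?E (r / (1 - e))"
      proof clarify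
        fix x assume x: "norm (f x) \<le> r"
        then have "c * norm x < c * d" using c(2)[of x] r(3) by simp
        then have "norm x < d" using c(1) by simp
        then have "(1 - e) * norm (Q *v x) \<le> norm (f x)" using d(2)[of x] by (simp add: algebra_simps)
        then show "norm (Q *v x) \<le> r / (1 - e)" using x e by (simp add: field_simps)
      qed
      then have 2: "measure lebesgue (?S r) \<le> measure lebesgue (?E (r / (1 - e)))"
        using e r(1) S measure_ellipsoid(1)[OF Q, of "r / (1 - e)"]
        by (intro measure_mono_fmeasurable) (auto simp: fmeasurableD)
      have "V * (r / (1 + e)) ^ ?n \<le> measure lebesgue (?S r)"
           "measure lebesgue (?S r) \<le> V * (r / (1 - e)) ^ ?n"
        using 1 2 e r(1) by (simp_all add: measure_ellipsoid(2)[OF Q] V_def)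
      then show ?case using r(1) by (simp add: power_divide field_simps)
    qed
  qed
  have near: "\<forall>\<^sub>F e in at_right (0::real). 0 < e \<and> e < 1"
    using eventually_at_right_real[of 0 "1::real"] by (auto elim: eventually_mono)
  show ?thesis
    unfolding V_def[symmetric]
  proof (rule order_tendstoI)
    fix a assume a: "a < V"
    have "((\<lambda>e. V / (1 + e) ^ ?n) \<longlongrightarrow> V / (1 + 0) ^ ?n) (at_right 0)"
      by (intro tendsto_intros) auto
    then have "\<forall>\<^sub>F e in at_right 0. a < V / (1 + e) ^ ?n" using order_tendstoD(1) a by fastforce
    from eventually_happens'[OF trivial_limit_at_right_real eventually_conj[OF near this]]
    obtain e where "0 < e" "e < 1" "a < V / (1 + e) ^ ?n" by blast
    then show "\<forall>\<^sub>F r in at_right 0. a < measure lebesgue (?S r) / r ^ ?n"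
      using squeeze[of e] by (auto elim: eventually_mono)
  next
    fix a assume a: "V < a"
    have "((\<lambda>e. V / (1 - e) ^ ?n) \<longlongrightarrow> V / (1 - 0) ^ ?n) (at_right 0)"
      by (intro tendsto_intros) auto
    then have "\<forall>\<^sub>F e in at_right 0. V / (1 - e) ^ ?n < a" using order_tendstoD(2) a by fastforce
    from eventually_happens'[OF trivial_limit_at_right_real eventually_conj[OF near this]]
    obtain e where "0 < e" "e < 1" "V / (1 - e) ^ ?n < a" by blast
    then show "\<forall>\<^sub>F r in at_right 0. measure lebesgue (?S r) / r ^ ?n < a"
      using squeeze[of e] by (auto elim: eventually_mono)
  qed
qed

lemma inner_transpose_vector:
  fixes A :: "real ^ 'n ^ 'm"
  shows "x \<bullet> (transpose A *v y) = (A *v x) \<bullet> y"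
  by (metis dot_lmul_matrix inner_commute transpose_matrix_vector)

text \<open>
  The range of the injective map \<open>R\<close> is isometric to \<open>\<real>\<^sup>n\<close>; composing \<open>R\<close> with such an isometry
  gives a square matrix with the same Gram matrix, whose determinant is then \<open>(det Q)\<^sup>2\<close>.
\<close>

lemma gram_square_factor:
  fixes R :: "real ^ 'n ^ 'k"
  assumes inj: "inj ((*v) R)"
  obtains Q :: "real ^ 'n ^ 'n" where "invertible Q" "\<And>x. norm (Q *v x) = norm (R *v x)"
    "transpose Q ** Q = transpose R ** R"
proof -
  let ?T = "range ((*v) R)"
  have lin: "linear ((*v) R)" by simp
  have "dim ?T = dim (UNIV :: (real ^ 'n) set)"
    by (rule dim_image_eq[OF lin]) (simp add: inj)
  then obtain g :: "real ^ 'k \<Rightarrow> real ^ 'n" where fg: "linear g" "\<And>y. y \<in> ?T \<Longrightarrow> norm (g y) = norm y"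
    using isometry_subspaces[OF linear_subspace_image[OF lin subspace_UNIV] subspace_UNIV] by metis
  define Q where "Q = matrix (g \<circ> (*v) R)"
  have Qx: "Q *v x = g (R *v x)" for x
    using linear_compose[OF lin fg(1)] by (simp add: Q_def)
  have norm: "norm (Q *v x) = norm (R *v x)" for x by (simp add: Qx fg(2))
  have "inj ((*v) Q)"
    unfolding linear_injective_0[OF matrix_vector_mul_linear]
  proof (intro allI impI)
    fix x assume "Q *v x = 0"
    then have "R *v x = R *v 0" using norm[of x] by simp
    then show "x = 0" by (rule injD[OF inj])
  qed
  then have inv: "invertible Q"
    by (metis invertible_left_inverse matrix_left_invertible_injective)
  have inner: "(Q *v x) \<bullet> (Q *v y) = (R *v x) \<bullet> (R *v y)" for x y
    unfolding dot_norm matrix_vector_right_distrib[symmetric] norm ..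
  have "transpose Q ** Q = transpose R ** R"
    unfolding matrix_eq
  proof
    fix x
    have "y \<bullet> (transpose Q ** Q *v x) = y \<bullet> (transpose R ** R *v x)" for y
      by (simp only: inner_transpose_vector inner flip: matrix_vector_mul_assoc)
    then show "transpose Q ** Q *v x = transpose R ** R *v x"
      by (rule vector_eq_ldot[THEN iffD1, OF allI])
  qed
  then show ?thesis by (rule that[OF inv norm])
qed

section \<open>Kronecker products and the spectral norm\<close>

lemma kron_mat_mult:
  fixes A :: "real ^ 'b::finite ^ 'a::finite" and B :: "real ^ 'e::finite ^ 'd::finite"
    and C :: "real ^ 'c::finite ^ 'b" and D :: "real ^ 'f::finite ^ 'e"
  shows "kron_mat A B ** kron_mat C D = kron_mat (A ** C) (B ** D)"
  by (simp add: kron_mat_def matrix_matrix_mult_def vec_eq_iff sum_product mult.assoc mult.left_commute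
      sum.cartesian_product case_prod_beta flip: UNIV_Times_UNIV)

lemma transpose_kron_mat: "transpose (kron_mat A B) = kron_mat (transpose A) (transpose B)"
  by (simp add: kron_mat_def transpose_def vec_eq_iff)

lemma kron_mat_id: "kron_mat (mat 1 :: real ^ 'a ^ 'a) (mat 1 :: real ^ 'b ^ 'b) = mat 1"
  by (auto simp: kron_mat_def mat_def vec_eq_iff prod_eq_iff)

lemma invertible_kron_mat_id:
  fixes A :: "real ^ 'a::finite ^ 'a"
  assumes "invertible A"
  shows "invertible (kron_mat A (mat 1 :: real ^ 'b::finite ^ 'b))"
proof -
  obtain A' where "A ** A' = mat 1" using assms unfolding invertible_def by blast
  then have "kron_mat A (mat 1 :: real ^ 'b ^ 'b) ** kron_mat A' (mat 1) = mat 1"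
    by (simp add: kron_mat_mult kron_mat_id)
  then show ?thesis by (metis invertible_right_inverse)
qed

lemma spectral_norm_nonneg: "0 \<le> spectral_norm X"
  unfolding spectral_norm_def by (rule onorm_pos_le) (simp add: matrix_vector_mul_bounded_linear)

lemma spectral_norm_eq_0_iff: "spectral_norm X = 0 \<longleftrightarrow> X = 0"
  unfolding spectral_norm_def
  by (subst onorm_eq_0) (auto simp: matrix_vector_mul_bounded_linear matrix_eq)

lemma spectral_norm_le_iff:
  fixes X :: "real ^ 'b ^ 'a"
  shows "spectral_norm X \<le> t \<longleftrightarrow> (\<forall>v. norm (X *v v) \<le> t * norm v)"
proof
  assume "spectral_norm X \<le> t"
  then show "\<forall>v. norm (X *v v) \<le> t * norm v"
    unfolding spectral_norm_def
    by (meson matrix_vector_mul_bounded_linear mult_right_mono norm_ge_zero onorm order_trans)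
qed (simp add: spectral_norm_def onorm_le)

lemma matrix_inv_cancel:
  fixes E :: "real ^ 'a ^ 'a"
  assumes "invertible E"
  shows "E ** matrix_inv E = mat 1" "matrix_inv E ** E = mat 1"
  using someI_ex[OF assms[unfolded invertible_def]] unfolding matrix_inv_def by auto

text \<open>
  The norm of \<open>y = E\<^sup>-\<^sup>1 G v\<close> is tested against all \<open>s\<close>, and every \<open>s\<close> has the form \<open>E\<^sup>T u\<close>, for which
  \<open>s \<bullet> y = u \<bullet> G v\<close>. The inverse disappears, which makes the condition closed in all its data.
\<close>

lemma spectral_norm_inv_mult_le_iff:
  fixes E :: "real ^ 'a ^ 'a" and G :: "real ^ 'b ^ 'a"
  assumes E: "invertible E"
  shows "spectral_norm (matrix_inv E ** G) \<le> t
     \<longleftrightarrow> (\<forall>u v. u \<bullet> (G *v v) \<le> t * norm v * norm (transpose E *v u))"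
proof -
  have norm_le: "norm y \<le> c \<longleftrightarrow> (\<forall>s. s \<bullet> y \<le> c * norm s)" for y :: "real ^ 'a" and c
  proof
    assume "norm y \<le> c"
    then have "norm s * norm y \<le> c * norm s" for s :: "real ^ 'a"
      using mult_right_mono[of "norm y" c "norm s"] by (simp add: mult.commute)
    then show "\<forall>s. s \<bullet> y \<le> c * norm s" using norm_cauchy_schwarz order_trans by blast
  next
    assume *: "\<forall>s. s \<bullet> y \<le> c * norm s"
    show "norm y \<le> c"
    proof (cases "y = 0")
      case True
      have "0 \<le> c * norm (axis undefined 1 :: real ^ 'a)"
        using *[rule_format, of "axis undefined 1"] True by simp
      then show ?thesis using True by simp
    next
      case False
      then show ?thesis using *[rule_format, of y] by (simp add: power2_norm_eq_inner[symmetric] power2_eq_square)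
    qed
  qed
  have surj: "\<exists>u. s = transpose E *v u" for s
  proof
    show "s = transpose E *v (transpose (matrix_inv E) *v s)"
      by (simp only: matrix_vector_mul_assoc flip: matrix_transpose_mul)
         (simp add: matrix_inv_cancel[OF E] transpose_mat)
  qed
  have pair: "(transpose E *v u) \<bullet> (matrix_inv E *v y) = u \<bullet> y" for u y
  proof -
    have "(transpose E *v u) \<bullet> (matrix_inv E *v y) = u \<bullet> (E *v (matrix_inv E *v y))"
      using inner_transpose_vector[of u "transpose E" "matrix_inv E *v y"] by (simp only: transpose_transpose)
    then show ?thesis by (simp only: matrix_vector_mul_assoc matrix_inv_cancel[OF E] matrix_vector_mul_lid)
  qed
  have "spectral_norm (matrix_inv E ** G) \<le> t
      \<longleftrightarrow> (\<forall>v s. s \<bullet> (matrix_inv E *v (G *v v)) \<le> t * norm v * norm s)"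
    unfolding spectral_norm_le_iff norm_le by (simp only: matrix_vector_mul_assoc)
  also have "\<dots> \<longleftrightarrow> (\<forall>v u. u \<bullet> (G *v v) \<le> t * norm v * norm (transpose E *v u))"
    using surj pair by metis
  finally show ?thesis by blast
qed

text \<open>
  For \<open>E = F\<^sup>T \<otimes> I\<close> the product \<open>E E\<^sup>T\<close> is \<open>F\<^sup>T F \<otimes> I\<close>: only the Gram matrix of \<open>F\<close> matters.
\<close>

lemma norm_transpose_kron_mat:
  fixes F :: "real ^ 'k ^ 'k"
  shows "norm (transpose (kron_mat (transpose F) (mat 1 :: real ^ 'k ^ 'k)) *v u)
       = sqrt (u \<bullet> (kron_mat (transpose F ** F) (mat 1) *v u))"
proof -
  let ?E = "kron_mat (transpose F) (mat 1 :: real ^ 'k ^ 'k)"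
  have "(transpose ?E *v u) \<bullet> (transpose ?E *v u) = u \<bullet> (?E *v (transpose ?E *v u))"
    using inner_transpose_vector[of u "transpose ?E" "transpose ?E *v u"] by (simp only: transpose_transpose)
  also have "?E *v (transpose ?E *v u) = kron_mat (transpose F ** F) (mat 1) *v u"
    by (simp add: matrix_vector_mul_assoc transpose_kron_mat kron_mat_mult transpose_mat)
  finally show ?thesis by (simp add: norm_eq_sqrt_inner)
qed

section \<open>Gauge orbits of the certificate\<close>

text \<open>
  With \<open>X = P H\<close> and \<open>P\<close> symmetric, the blocks \<open>M\<^sub>i\<^sup>T P + P M\<^sub>i\<close> of \<open>G\<close> are \<open>X\<^sub>i\<^sup>T + X\<^sub>i\<close>. This linear map of \<open>X\<close> is
  independent of \<open>\<Lambda>\<close>.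
\<close>

definition sym_stack :: "real ^ ('k \<times> 'k) ^ 'k \<Rightarrow> real ^ 'k ^ ('k \<times> 'k)" where
  "sym_stack X = (\<chi> q. (transpose (block X (fst q)) + block X (fst q)) $ snd q)"

lemma linear_sym_stack: "linear sym_stack"
  by (rule linearI) (auto simp: sym_stack_def block_def transpose_def vec_eq_iff algebra_simps)

lemma block_mult: "block (P ** X) i = P ** block X i"
  by (simp add: block_def matrix_matrix_mult_def vec_eq_iff)

lemma GL_eq_sym_stack:
  assumes "transpose (PL D \<Lambda>) = PL D \<Lambda>"
  shows "GL D \<Lambda> \<mu> = sym_stack (PL D \<Lambda> ** HL D \<Lambda> \<mu>)"
  by (simp add: GL_def sym_stack_def block_mult matrix_transpose_mul assms)

lemma gauge_space_mult: "K \<in> gauge_space \<Longrightarrow> P ** K \<in> gauge_space"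
  by (simp add: gauge_space_def flip: matrix_vector_mul_assoc)

lemma subspace_gauge_space: "subspace gauge_space"
  by (auto simp: subspace_def gauge_space_def matrix_vector_mult_add_rdistrib scaleR_matrix_vector_assoc[symmetric])

text \<open>
  \<open>F v = 0\<close> gives \<open>P v = 0\<close>, and then \<open>v\<^sup>T (A\<^sup>T P + P A) v = 0\<close>, while the equation makes it \<open>-|v|\<^sup>2\<close>.
\<close>

lemma lyapunov_certificate:
  assumes "certificate_factors D" "\<Lambda> \<in> feasible D"
  shows "transpose (AL D \<Lambda>) ** PL D \<Lambda> + PL D \<Lambda> ** AL D \<Lambda> = - mat 1"
    and "PL D \<Lambda> = transpose (fac D \<Lambda>) ** fac D \<Lambda>"
    and "transpose (PL D \<Lambda>) = PL D \<Lambda>"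
    and "invertible (fac D \<Lambda>)"
    and "invertible (PL D \<Lambda>)"
proof -
  let ?A = "AL D \<Lambda>" and ?P = "PL D \<Lambda>" and ?F = "fac D \<Lambda>"
  show eq: "transpose ?A ** ?P + ?P ** ?A = - mat 1"
    using assms(2) unfolding PL_def by (intro lyap_sol_equation) (simp add: feasible_def)
  show P: "?P = transpose ?F ** ?F" using assms by (simp add: certificate_factors_def)
  show sym: "transpose ?P = ?P" by (simp add: P matrix_transpose_mul)
  have "v = 0" if "?F *v v = 0" for v
  proof -
    have "?P *v v = 0" by (simp add: P that flip: matrix_vector_mul_assoc)
    then have "v \<bullet> (?P *v (?A *v v)) = 0" "v \<bullet> (transpose ?A *v (?P *v v)) = 0"
      using inner_transpose_vector[of v ?P "?A *v v"] by (simp_all add: sym)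
    moreover have "v \<bullet> ((transpose ?A ** ?P + ?P ** ?A) *v v)
        = v \<bullet> (transpose ?A *v (?P *v v)) + v \<bullet> (?P *v (?A *v v))"
      by (simp add: matrix_vector_mult_add_rdistrib inner_add_right matrix_vector_mul_assoc)
    ultimately have "v \<bullet> ((- mat 1 :: real ^ 'b ^ 'b) *v v) = 0" by (simp add: eq)
    then show "v = 0" using matrix_vector_mult_diff_rdistrib[of 0 "mat 1" v] by simp
  qed
  then show F: "invertible ?F"
    by (metis invertible_left_inverse matrix_left_invertible_ker)
  show "invertible ?P" unfolding P
    by (intro invertible_mult F transpose_invertible)
qed

lemma gauge_space_combination:
  fixes D :: "('n::finite, 'k::finite) lift"
  assumes "gauge_basis D"
  shows "K \<in> gauge_space \<longleftrightarrow>
    (\<exists>\<mu>\<in>tuples (gauge_dim TYPE('k)). K = (\<Sum>k<gauge_dim TYPE('k). \<mu> k *\<^sub>R gb D k))"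
proof -
  let ?I = "{..<gauge_dim TYPE('k)}"
  have inj: "inj_on (gb D) ?I" and sp: "span (gb D ` ?I) = gauge_space"
    using assms by (auto simp: gauge_basis_def Let_def)
  have "K \<in> gauge_space \<longleftrightarrow> (\<exists>u. K = (\<Sum>v\<in>gb D ` ?I. u v *\<^sub>R v))"
    by (auto simp: sp[symmetric] span_finite)
  also have "\<dots> \<longleftrightarrow> (\<exists>\<mu>\<in>tuples (gauge_dim TYPE('k)). K = (\<Sum>k\<in>?I. \<mu> k *\<^sub>R gb D k))"
  proof (intro iffI; elim exE bexE)
    fix u assume "K = (\<Sum>v\<in>gb D ` ?I. u v *\<^sub>R v)"
    then have "K = (\<Sum>k\<in>?I. restrict (u \<circ> gb D) ?I k *\<^sub>R gb D k)"
      by (simp add: sum.reindex[OF inj])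
    then show "\<exists>\<mu>\<in>tuples (gauge_dim TYPE('k)). K = (\<Sum>k\<in>?I. \<mu> k *\<^sub>R gb D k)" by blast
  next
    fix \<mu> assume "K = (\<Sum>k\<in>?I. \<mu> k *\<^sub>R gb D k)"
    then have "K = (\<Sum>v\<in>gb D ` ?I. \<mu> (inv_into ?I (gb D) v) *\<^sub>R v)"
      by (simp add: sum.reindex[OF inj] inv_into_f_f[OF inj])
    then show "\<exists>u. K = (\<Sum>v\<in>gb D ` ?I. u v *\<^sub>R v)"
      by (rule exI[of _ "\<lambda>v. \<mu> (inv_into ?I (gb D) v)"])
  qed
  finally show ?thesis .
qed

text \<open>
  For feasible \<open>\<Lambda>\<close> this is \<open>G(\<Lambda>, 0)\<close>, the point from which the gauge directions start.
\<close>

definition base_stack :: "('n::finite, 'k::finite) lift \<Rightarrow> (nat \<Rightarrow> real) \<Rightarrow> real ^ 'k ^ ('k \<times> 'k)" where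
  "base_stack D \<Lambda> = sym_stack (PL D \<Lambda> ** HL D \<Lambda> (\<lambda>_. 0))"

text \<open>
  \<open>G(\<Lambda>, \<mu>)\<close> is affine in \<open>P K(\<mu>)\<close>, and \<open>K \<mapsto> P K\<close> maps the gauge space onto itself because \<open>P\<close> is invertible.
  So the subspace of directions does not change with \<open>\<Lambda>\<close>, although the kernel of \<open>\<mu> \<mapsto> G(\<Lambda>, \<mu>)\<close> may.
\<close>

lemma GL_gauge_orbit:
  fixes D :: "('n::finite, 'k::finite) lift"
  assumes "gauge_basis D" "certificate_factors D" "\<Lambda> \<in> feasible D"
  shows "GL D \<Lambda> ` tuples (gauge_dim TYPE('k)) = (+) (base_stack D \<Lambda>) ` sym_stack ` gauge_space"
proof -
  let ?P = "PL D \<Lambda>" and ?K = "\<lambda>\<mu>. \<Sum>k<gauge_dim TYPE('k). \<mu> k *\<^sub>R gb D k"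
  note cert = lyapunov_certificate[OF assms(2,3)]
  have GL: "GL D \<Lambda> \<mu> = base_stack D \<Lambda> + sym_stack (?P ** ?K \<mu>)" for \<mu>
  proof -
    have "HL D \<Lambda> \<mu> = HL D \<Lambda> (\<lambda>_. 0) + ?K \<mu>" by (simp add: HL_def)
    then show ?thesis
      unfolding GL_eq_sym_stack[OF cert(3)] base_stack_def
      by (simp only: matrix_add_ldistrib linear_add[OF linear_sym_stack])
  qed
  have "?K ` tuples (gauge_dim TYPE('k)) = gauge_space"
    using gauge_space_combination[OF assms(1)] by auto
  moreover have "(**) ?P ` gauge_space = gauge_space"
  proof
    show "gauge_space \<subseteq> (**) ?P ` gauge_space"
    proof
      fix K :: "real ^ ('k \<times> 'k) ^ 'k" assume "K \<in> gauge_space"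
      moreover have "K = ?P ** (matrix_inv ?P ** K)"
        by (simp add: matrix_mul_assoc matrix_inv_cancel[OF cert(5)])
      ultimately show "K \<in> (**) ?P ` gauge_space" using gauge_space_mult by blast
    qed
  qed (auto intro: gauge_space_mult)
  ultimately have range_K: "gauge_space = (**) ?P ` ?K ` tuples (gauge_dim TYPE('k))" by simp
  show ?thesis by (subst range_K, unfold image_image) (rule image_cong[OF refl GL])
qed

lemma spectral_norm_JL_le_iff:
  assumes "certificate_factors D" "\<Lambda> \<in> feasible D"
  shows "spectral_norm (JL D \<Lambda> \<mu>) \<le> t \<longleftrightarrow>
    (\<forall>u v. u \<bullet> (GL D \<Lambda> \<mu> *v v) \<le> t * norm v * sqrt (u \<bullet> (kron_mat (PL D \<Lambda>) (mat 1) *v u)))"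
proof -
  note cert = lyapunov_certificate[OF assms]
  have "invertible (kron_mat (transpose (fac D \<Lambda>)) (mat 1 :: real ^ 'b ^ 'b))"
    by (intro invertible_kron_mat_id transpose_invertible cert)
  then show ?thesis
    unfolding JL_def by (simp only: spectral_norm_inv_mult_le_iff norm_transpose_kron_mat cert(2)[symmetric])
qed

lemma JL_eq_0_iff:
  assumes "certificate_factors D" "\<Lambda> \<in> feasible D"
  shows "JL D \<Lambda> \<mu> = 0 \<longleftrightarrow> GL D \<Lambda> \<mu> = 0"
proof -
  let ?E = "kron_mat (transpose (fac D \<Lambda>)) (mat 1 :: real ^ 'b ^ 'b)"
  have "invertible ?E"
    by (intro invertible_kron_mat_id transpose_invertible lyapunov_certificate[OF assms])
  then have "?E ** JL D \<Lambda> \<mu> = GL D \<Lambda> \<mu>"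
    unfolding JL_def by (simp add: matrix_mul_assoc matrix_inv_cancel)
  then show ?thesis by (auto simp: JL_def)
qed

section \<open>Existence of optimal gains and gauges\<close>

lemma compact_PiE_lessThan:
  fixes lo hi :: "nat \<Rightarrow> real"
  shows "compact (\<Pi>\<^sub>E i\<in>{..<m}. {lo i..hi i})"
proof -
  let ?S = "\<lambda>i. if i < m then {lo i..hi i} else {undefined}"
  have eq: "(\<Pi>\<^sub>E i\<in>{..<m}. {lo i..hi i}) = PiE UNIV ?S"
  proof (intro set_eqI iffI)
    fix f assume "f \<in> (\<Pi>\<^sub>E i\<in>{..<m}. {lo i..hi i})"
    then show "f \<in> PiE UNIV ?S" by (auto simp: PiE_iff extensional_def)
  next
    fix f assume f: "f \<in> PiE UNIV ?S"
    have "f i \<in> ?S i" for i using PiE_mem[OF f UNIV_I] .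
    then have "f i \<in> {lo i..hi i}" if "i < m" for i using that by (metis (full_types))
    moreover have "f i = undefined" if "\<not> i < m" for i using \<open>f i \<in> ?S i\<close> that by simp
    ultimately show "f \<in> (\<Pi>\<^sub>E i\<in>{..<m}. {lo i..hi i})"
      unfolding PiE_iff extensional_def by blast
  qed
  have "compactin (product_topology (\<lambda>_. euclidean) UNIV) (PiE UNIV ?S)"
    unfolding compactin_PiE by (intro disjI2 ballI) simp
  then show ?thesis unfolding eq euclidean_product_topology compactin_euclidean_iff .
qed

lemma bounded_bilinear_matrix_mult:
  "bounded_bilinear ((**) :: real ^ 'b ^ 'a \<Rightarrow> real ^ 'c ^ 'b \<Rightarrow> real ^ 'c ^ 'a)"
  unfolding bilinear_conv_bounded_bilinear[symmetric] bilinear_def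
  by (auto intro!: linearI simp: vec_eq_iff matrix_matrix_mult_def sum.distrib sum_distrib_left algebra_simps)

lemma norm_matrix_le_components:
  fixes X :: "real ^ 'b ^ 'a"
  assumes "\<And>i j. \<bar>X $ i $ j\<bar> \<le> c"
  shows "norm X \<le> real (CARD('a) * CARD('b)) * c"
proof -
  have "norm X \<le> (\<Sum>i\<in>UNIV. norm (X $ i))" by (simp add: norm_vec_def L2_set_le_sum)
  also have "\<dots> \<le> (\<Sum>i\<in>(UNIV :: 'a set). \<Sum>j\<in>(UNIV :: 'b set). c)"
    by (intro sum_mono order_trans[OF norm_le_l1_cart] assms)
  finally show ?thesis by simp
qed

lemma continuous_on_linear_comp:
  fixes f :: "'a::topological_space \<Rightarrow> 'b::euclidean_space" and g :: "'b \<Rightarrow> 'c::real_normed_vector"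
  assumes "continuous_on S f" "linear g"
  shows "continuous_on S (\<lambda>x. g (f x))"
  using continuous_on_compose2[OF linear_continuous_on assms(1), of g UNIV] assms(2)
  by (simp add: linear_conv_bounded_linear)

lemma continuous_on_certificate:
  assumes "certificate_factors D" "B \<subseteq> feasible D"
  shows "continuous_on B (PL D)" "continuous_on B (base_stack D)"
proof -
  have coord: "continuous_on B (\<lambda>\<Lambda>. \<Lambda> i)" for i :: nat
    by (rule continuous_on_subset[OF continuous_on_product_coordinates]) simp
  have "continuous_on B (AL D)"
    unfolding AL_def by (intro continuous_intros coord)
  then show PL: "continuous_on B (PL D)"
    unfolding PL_def using assms(2)
    by (intro continuous_on_compose2[OF continuous_on_lyap_sol]) (auto simp: feasible_def)
  have HL: "continuous_on B (\<lambda>\<Lambda>. HL D \<Lambda> (\<lambda>_. 0))"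
    unfolding HL_def by (intro continuous_intros coord)
  show "continuous_on B (base_stack D)"
    unfolding base_stack_def
    by (rule continuous_on_linear_comp[OF
          bounded_bilinear.continuous_on[OF bounded_bilinear_matrix_mult PL HL] linear_sym_stack])
qed

text \<open>
  The pairs \<open>(\<Lambda>, \<mu>)\<close> do not suit a compactness argument: \<open>\<mu> \<mapsto> J(\<Lambda>, \<mu>)\<close> need not be injective, so a bound
  on \<open>\<parallel>J\<parallel>\<close> need not bound \<open>\<mu>\<close>, and \<open>P\<^sub>f\<close> need not be continuous in \<open>\<Lambda>\<close>. Replacing \<open>\<mu>\<close> by \<open>Z = G(\<Lambda>, \<mu>) - G(\<Lambda>, 0)\<close>, which ranges over the fixed subspace \<open>W\<close>, and
  \<open>\<parallel>J\<parallel> \<le> t\<close> by its dual form removes both obstacles: the condition on \<open>(\<Lambda>, Z, t)\<close> is closed, and it bounds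
  \<open>Z\<close> when \<open>t\<close> is bounded.
\<close>

lemma joint_minimum:
  fixes D :: "('n::finite, 'k::finite) lift"
  assumes gb: "gauge_basis D" and cf: "certificate_factors D"
    and box: "gain_box (ldim D) B" and feas: "B \<subseteq> feasible D"
  shows "\<exists>\<Lambda>\<in>B. \<exists>\<mu>\<in>tuples (gauge_dim TYPE('k)). \<forall>\<Lambda>'\<in>B. \<forall>\<mu>'\<in>tuples (gauge_dim TYPE('k)).
            spectral_norm (JL D \<Lambda> \<mu>) \<le> spectral_norm (JL D \<Lambda>' \<mu>')"
proof -
  let ?T = "tuples (gauge_dim TYPE('k))"
  define W :: "(real ^ 'k ^ ('k \<times> 'k)) set" where "W = sym_stack ` gauge_space"
  have orbit: "GL D \<Lambda> ` ?T = (+) (base_stack D \<Lambda>) ` W" if "\<Lambda> \<in> B" for \<Lambda>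
    unfolding W_def by (rule GL_gauge_orbit[OF gb cf subsetD[OF feas that]])
  have "closed W" unfolding W_def
    by (intro closed_subspace linear_subspace_image linear_sym_stack subspace_gauge_space)
  have "compact B" "B \<noteq> {}" using box compact_PiE_lessThan by (auto simp: gain_box_def)
  note cont = continuous_on_certificate[OF cf feas]
  obtain \<beta> where \<beta>: "\<And>\<Lambda>. \<Lambda> \<in> B \<Longrightarrow> norm (base_stack D \<Lambda>) \<le> \<beta>"
    using compact_imp_bounded[OF compact_continuous_image[OF cont(2) \<open>compact B\<close>]] by (auto simp: bounded_iff)
  obtain \<pi> where \<pi>: "\<And>\<Lambda>. \<Lambda> \<in> B \<Longrightarrow> norm (PL D \<Lambda>) \<le> \<pi>"
    using compact_imp_bounded[OF compact_continuous_image[OF cont(1) \<open>compact B\<close>]] by (auto simp: bounded_iff)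
  obtain \<Lambda>0 where "\<Lambda>0 \<in> B" using \<open>B \<noteq> {}\<close> by blast
  define \<mu>0 :: "nat \<Rightarrow> real" where "\<mu>0 = (\<lambda>_. undefined)"
  have "\<mu>0 \<in> ?T" by (simp add: \<mu>0_def extensional_def)
  \<comment> \<open>The value \<open>t0\<close> is taken, so the search may be restricted to \<open>t \<le> t0\<close>.\<close>
  define t0 where "t0 = spectral_norm (JL D \<Lambda>0 \<mu>0)"
  have "t0 \<ge> 0" by (simp add: t0_def spectral_norm_nonneg)
  define bnd where "bnd u v \<Lambda> t = t * norm v * sqrt (u \<bullet> (kron_mat (PL D \<Lambda>) (mat 1) *v u))"
    for u :: "real ^ ('k \<times> 'k)" and v :: "real ^ 'k" and \<Lambda> t
  \<comment> \<open>\<open>C\<close> bounds \<open>Z\<close>: testing the dual condition with unit vectors bounds the entries of \<open>G\<close> by \<open>t0 \<surd>\<pi>\<close>.\<close>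
  define C where "C = real (CARD('k \<times> 'k) * CARD('k)) * (t0 * sqrt \<pi> + \<beta>)"
  define K where "K = B \<times> (W \<inter> cball 0 C) \<times> {0..t0}"
  define S where "S = (\<Inter>u. \<Inter>v. {(\<Lambda>, Z, t) \<in> K. u \<bullet> ((base_stack D \<Lambda> + Z) *v v) \<le> bnd u v \<Lambda> t})"
  have "compact K" unfolding K_def
    by (intro compact_Times \<open>compact B\<close> closed_Int_compact \<open>closed W\<close>) auto
  have contK: "continuous_on K (\<lambda>z. h (fst z))" if "continuous_on B h" for h :: "_ \<Rightarrow> 'z::topological_space"
    by (rule continuous_on_compose2[OF that]) (auto simp: K_def intro: continuous_intros)
  have "closedin (top_of_set K) {(\<Lambda>, Z, t) \<in> K. u \<bullet> ((base_stack D \<Lambda> + Z) *v v) \<le> bnd u v \<Lambda> t}" for u v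
  proof -
    have lin1: "linear (\<lambda>X. u \<bullet> (X *v v))"
      by (auto intro!: linearI simp: matrix_vector_mult_add_rdistrib inner_add_right scaleR_matrix_vector_assoc[symmetric])
    have lin2: "linear (\<lambda>X :: real ^ 'k ^ 'k. u \<bullet> (kron_mat X (mat 1 :: real ^ 'k ^ 'k) *v u))"
    proof (rule linearI)
      have "kron_mat (X + Y) (mat 1) = kron_mat X (mat 1) + kron_mat Y (mat 1 :: real ^ 'k ^ 'k)"
           "kron_mat (c *\<^sub>R X) (mat 1) = c *\<^sub>R kron_mat X (mat 1 :: real ^ 'k ^ 'k)" for X Y :: "real ^ 'k ^ 'k" and c
        by (auto simp: kron_mat_def vec_eq_iff algebra_simps)
      then show "u \<bullet> (kron_mat (X + Y) (mat 1) *v u) = u \<bullet> (kron_mat X (mat 1) *v u) + u \<bullet> (kron_mat Y (mat 1 :: real ^ 'k ^ 'k) *v u)"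
         "u \<bullet> (kron_mat (c *\<^sub>R X) (mat 1 :: real ^ 'k ^ 'k) *v u) = c *\<^sub>R (u \<bullet> (kron_mat X (mat 1) *v u))" for X Y :: "real ^ 'k ^ 'k" and c
        by (simp_all add: matrix_vector_mult_add_rdistrib inner_add_right scaleR_matrix_vector_assoc[symmetric])
    qed
    let ?f = "\<lambda>z. bnd u v (fst z) (snd (snd z)) - u \<bullet> ((base_stack D (fst z) + fst (snd z)) *v v)"
    have "continuous_on K ?f"
      unfolding bnd_def
      by (intro continuous_intros continuous_on_linear_comp[OF _ lin1]
          contK[OF continuous_on_linear_comp[OF cont(1) lin2]] contK[OF cont(2)])
    then have "closedin (top_of_set K) (K \<inter> ?f -` {0..})"
      by (rule continuous_closedin_preimage) auto
    moreover have "K \<inter> ?f -` {0..} = {(\<Lambda>, Z, t) \<in> K. u \<bullet> ((base_stack D \<Lambda> + Z) *v v) \<le> bnd u v \<Lambda> t}"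
      by auto
    ultimately show ?thesis by simp
  qed
  then have "closedin (top_of_set K) S" unfolding S_def by (intro closedin_INT) auto
  then have "compact S" using \<open>compact K\<close> closedin_compact by blast
  have S_iff: "(\<Lambda>, Z, t) \<in> S \<longleftrightarrow> (\<Lambda>, Z, t) \<in> K \<and> spectral_norm (JL D \<Lambda> \<mu>) \<le> t"
    if "\<Lambda> \<in> B" "GL D \<Lambda> \<mu> = base_stack D \<Lambda> + Z" for \<Lambda> Z t \<mu>
    using spectral_norm_JL_le_iff[OF cf, of \<Lambda> \<mu> t] feas that by (auto simp: S_def bnd_def)
  have in_S: "\<exists>Z. (\<Lambda>, Z, spectral_norm (JL D \<Lambda> \<mu>)) \<in> S"
    if \<Lambda>: "\<Lambda> \<in> B" and \<mu>: "\<mu> \<in> ?T" and le: "spectral_norm (JL D \<Lambda> \<mu>) \<le> t0" for \<Lambda> \<mu>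
  proof -
    obtain Z where Z: "Z \<in> W" "GL D \<Lambda> \<mu> = base_stack D \<Lambda> + Z"
      using orbit[OF \<Lambda>] \<mu> by (metis imageE imageI)
    have key: "u \<bullet> (GL D \<Lambda> \<mu> *v v) \<le> t0 * norm v * sqrt (u \<bullet> (kron_mat (PL D \<Lambda>) (mat 1) *v u))" for u v
      using le spectral_norm_JL_le_iff[OF cf, of \<Lambda> \<mu> t0] feas \<Lambda> by auto
    have "\<bar>GL D \<Lambda> \<mu> $ q $ j\<bar> \<le> t0 * sqrt \<pi>" for q j
    proof -
      \<comment> \<open>The signs \<open>s = 1\<close> and \<open>s = -1\<close> bound an entry from above and from below.\<close>
      have comp: "(s *\<^sub>R axis q 1) \<bullet> (X *v axis j 1) = s * X $ q $ j" for s and X :: "real ^ 'k ^ ('k \<times> 'k)"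
        by (simp add: inner_axis' matrix_vector_mult_basis column_def)
      have "(s *\<^sub>R axis q 1) \<bullet> (kron_mat (PL D \<Lambda>) (mat 1) *v (s *\<^sub>R axis q 1)) = s\<^sup>2 * PL D \<Lambda> $ fst q $ fst q" for s
        by (simp add: inner_axis' matrix_vector_mult_basis column_def kron_mat_def mat_def matrix_vector_mult_scaleR power2_eq_square)
      moreover have "PL D \<Lambda> $ fst q $ fst q \<le> \<pi>"
        using \<pi>[OF \<Lambda>] Finite_Cartesian_Product.norm_nth_le[of "PL D \<Lambda>" "fst q"]
          Finite_Cartesian_Product.norm_nth_le[of "PL D \<Lambda> $ fst q" "fst q"] by simp
      ultimately have "s * GL D \<Lambda> \<mu> $ q $ j \<le> t0 * sqrt \<pi>" if "s = 1 \<or> s = -1" for s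
        using key[of "s *\<^sub>R axis q 1" "axis j 1"] that \<open>t0 \<ge> 0\<close> unfolding comp
        by (auto intro: order_trans[OF _ mult_left_mono])
      from this[of 1] this[of "-1"] show ?thesis by (simp add: abs_le_iff)
    qed
    moreover have "\<bar>base_stack D \<Lambda> $ q $ j\<bar> \<le> \<beta>" for q j
      using \<beta>[OF \<Lambda>] Finite_Cartesian_Product.norm_nth_le[of "base_stack D \<Lambda>" q]
        Finite_Cartesian_Product.norm_nth_le[of "base_stack D \<Lambda> $ q" j] by simp
    ultimately have "\<bar>Z $ q $ j\<bar> \<le> t0 * sqrt \<pi> + \<beta>" for q j
    proof -
      assume *: "\<And>q j. \<bar>GL D \<Lambda> \<mu> $ q $ j\<bar> \<le> t0 * sqrt \<pi>" "\<And>q j. \<bar>base_stack D \<Lambda> $ q $ j\<bar> \<le> \<beta>"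
      show ?thesis using *(1)[of q j] *(2)[of q j] by (simp add: Z(2))
    qed
    then have "norm Z \<le> C" unfolding C_def by (rule norm_matrix_le_components)
    then have "(\<Lambda>, Z, spectral_norm (JL D \<Lambda> \<mu>)) \<in> K"
      using Z(1) \<Lambda> le by (simp add: K_def spectral_norm_nonneg)
    then show ?thesis using S_iff[OF \<Lambda> Z(2)] by auto
  qed
  have "S \<noteq> {}" using in_S[OF \<open>\<Lambda>0 \<in> B\<close> \<open>\<mu>0 \<in> ?T\<close>] by (auto simp: t0_def)
  moreover have "continuous_on S (\<lambda>z. snd (snd z))" by (intro continuous_intros)
  ultimately obtain z where z: "z \<in> S" "\<And>y. y \<in> S \<Longrightarrow> snd (snd z) \<le> snd (snd y)"
    using continuous_attains_inf[OF \<open>compact S\<close>] by blast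
  obtain \<Lambda> Z t where "z = (\<Lambda>, Z, t)" by (rule prod_cases3)
  with z have min: "(\<Lambda>, Z, t) \<in> S" "\<And>z. z \<in> S \<Longrightarrow> t \<le> snd (snd z)" by auto
  then have \<Lambda>: "\<Lambda> \<in> B" "Z \<in> W" "t \<le> t0" by (auto simp: S_def K_def)
  then obtain \<mu> where \<mu>: "\<mu> \<in> ?T" "GL D \<Lambda> \<mu> = base_stack D \<Lambda> + Z"
    using orbit[OF \<Lambda>(1)] by (metis (no_types, lifting) imageE imageI)
  have "spectral_norm (JL D \<Lambda> \<mu>) \<le> t" using S_iff[OF \<Lambda>(1) \<mu>(2)] min(1) by blast
  moreover have "t \<le> spectral_norm (JL D \<Lambda>' \<mu>')" if "\<Lambda>' \<in> B" "\<mu>' \<in> ?T" for \<Lambda>' \<mu>'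
    using in_S[OF that] min(2) \<Lambda>(3) by (cases "spectral_norm (JL D \<Lambda>' \<mu>') \<le> t0") fastforce+
  ultimately show ?thesis using \<Lambda>(1) \<mu>(1) by (meson order_trans)
qed

lemma minimum_eqI:
  assumes "x \<in> S" "\<And>y. y \<in> S \<Longrightarrow> f x \<le> f y"
  shows "minimum f S = f x"
  unfolding minimum_def by (rule Least_equality) (use assms in auto)

text \<open>
  A single point is a box, so \<open>joint_minimum\<close> applies.
\<close>

lemma phi_attained:
  fixes D :: "('n::finite, 'k::finite) lift"
  assumes "gauge_basis D" "certificate_factors D" "\<Lambda> \<in> feasible D"
  obtains \<mu> where "\<mu> \<in> tuples (gauge_dim TYPE('k))" "phi D \<Lambda> = spectral_norm (JL D \<Lambda> \<mu>)"
    "\<And>\<mu>'. \<mu>' \<in> tuples (gauge_dim TYPE('k)) \<Longrightarrow> phi D \<Lambda> \<le> spectral_norm (JL D \<Lambda> \<mu>')"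
proof -
  have "\<Lambda> \<in> tuples (ldim D)" using assms(3) by (simp add: feasible_def)
  then have "{\<Lambda>} = (\<Pi>\<^sub>E i\<in>{..<ldim D}. {\<Lambda> i..\<Lambda> i})"
    by (intro set_eqI iffI) (auto simp: PiE_iff intro: extensionalityI)
  then have "gain_box (ldim D) {\<Lambda>}" unfolding gain_box_def by blast
  from joint_minimum[OF assms(1,2) this] assms(3)
  obtain \<mu> where "\<mu> \<in> tuples (gauge_dim TYPE('k))"
    "\<And>\<mu>'. \<mu>' \<in> tuples (gauge_dim TYPE('k)) \<Longrightarrow> spectral_norm (JL D \<Lambda> \<mu>) \<le> spectral_norm (JL D \<Lambda> \<mu>')"
    by blast
  moreover from this have "phi D \<Lambda> = spectral_norm (JL D \<Lambda> \<mu>)"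
    unfolding phi_def by (intro minimum_eqI)
  ultimately show ?thesis using that by simp
qed

lemma phi_box_attained:
  fixes D :: "('n::finite, 'k::finite) lift"
  assumes gb: "gauge_basis D" and cf: "certificate_factors D" and B: "admissible_gain_box D B"
  obtains \<Lambda> where "\<Lambda> \<in> B" "phi_box D B = phi D \<Lambda>" "\<And>\<Lambda>'. \<Lambda>' \<in> B \<Longrightarrow> phi_box D B \<le> phi D \<Lambda>'"
proof -
  have box: "gain_box (ldim D) B" and feas: "B \<subseteq> feasible D"
    using B by (auto simp: admissible_gain_box_def)
  obtain \<Lambda> \<mu> where min: "\<Lambda> \<in> B" "\<mu> \<in> tuples (gauge_dim TYPE('k))"
    "\<And>\<Lambda>' \<mu>'. \<Lambda>' \<in> B \<Longrightarrow> \<mu>' \<in> tuples (gauge_dim TYPE('k)) \<Longrightarrow> spectral_norm (JL D \<Lambda> \<mu>) \<le> spectral_norm (JL D \<Lambda>' \<mu>')"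
    using joint_minimum[OF gb cf box feas] by blast
  have le: "phi D \<Lambda> \<le> phi D \<Lambda>'" if "\<Lambda>' \<in> B" for \<Lambda>'
  proof -
    have "\<Lambda> \<in> feasible D" "\<Lambda>' \<in> feasible D" using feas that min(1) by auto
    then show ?thesis using phi_attained[OF gb cf] min that by (metis order_trans)
  qed
  then have "phi_box D B = phi D \<Lambda>" unfolding phi_box_def using min(1) by (intro minimum_eqI) auto
  then show ?thesis using that[OF min(1)] le by simp
qed

section \<open>The Lyapunov function at a gain with vanishing optimum\<close>

lemma matrix_vector_mult_sum_left: "(\<Sum>i\<in>I. A i) *v w = (\<Sum>i\<in>I. A i *v w)"
  for A :: "'i \<Rightarrow> real ^ 'b ^ 'a"
  by (induction I rule: infinite_finite_induct) (auto simp: matrix_vector_mult_add_rdistrib)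

lemma outer_vector_mult: "outer a b *v w = (b \<bullet> w) *\<^sub>R a"
  by (simp add: outer_def matrix_vector_mult_def vec_eq_iff inner_vec_def sum_distrib_left mult_ac)

text \<open>
  The coefficient matrix may be taken with any gauge parameter, because gauge terms vanish on \<open>w \<otimes> w\<close>.
\<close>

lemma FL_quadratic_form:
  fixes D :: "('n::finite, 'k::finite) lift"
  assumes "represents_products D" "gauge_basis D"
  shows "FL D \<Lambda> w = AL D \<Lambda> *v w + HL D \<Lambda> \<mu> *v kron_vec w w"
proof -
  have gauge: "gb D k *v kron_vec w w = 0" if "k < gauge_dim TYPE('k)" for k
  proof -
    have "gb D k \<in> gauge_space"
      using assms(2) that by (auto simp: gauge_basis_def Let_def intro: span_base)
    then show ?thesis by (simp add: gauge_space_def)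
  qed
  have "AL D \<Lambda> *v w = A0 D *v w - (\<Sum>i<ldim D. (\<Lambda> i * w $ yi D i) *\<^sub>R axis (yi D i) 1)"
    by (simp add: AL_def matrix_vector_mult_diff_rdistrib matrix_vector_mult_sum_left
        outer_vector_mult inner_axis' flip: scaleR_matrix_vector_assoc)
  moreover have "HL D \<Lambda> \<mu> *v kron_vec w w
      = H0 D *v kron_vec w w + (\<Sum>i<ldim D. (\<Lambda> i * (w $ fa D i * w $ fb D i)) *\<^sub>R axis (yi D i) 1)"
    using assms(1)
    by (simp add: HL_def matrix_vector_mult_add_rdistrib matrix_vector_mult_sum_left outer_vector_mult
        gauge represents_products_def flip: scaleR_matrix_vector_assoc)
  ultimately show ?thesis
    by (simp add: FL_def F0_def stabilizer_def right_diff_distrib scaleR_diff_left sum_subtractf)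
qed

lemma mult_kron_vec_blocks:
  "X *v kron_vec w w = (\<Sum>i\<in>UNIV. w $ i *\<^sub>R (block X i *v w))"
proof -
  have "(X *v kron_vec w w) $ r = (\<Sum>i\<in>UNIV. \<Sum>j\<in>UNIV. X $ r $ (i, j) * (w $ i * w $ j))" for r
    by (simp add: matrix_vector_mult_def kron_vec_def sum.cartesian_product case_prod_beta flip: UNIV_Times_UNIV)
  then show ?thesis
    by (simp add: vec_eq_iff block_def matrix_vector_mult_def sum_distrib_left mult_ac)
qed

text \<open>
  Each block of \<open>X\<close> is skew-symmetric, and \<open>w \<bullet> X (w \<otimes> w) = \<Sum>\<^sub>i w\<^sub>i (w \<bullet> X\<^sub>i w)\<close>.
\<close>

lemma sym_stack_eq_0_cubic:
  assumes "sym_stack X = 0"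
  shows "w \<bullet> (X *v kron_vec w w) = 0"
proof -
  have "w \<bullet> (block X i *v w) = 0" for i
  proof -
    have "sym_stack X $ (i, r) = 0" for r using assms by simp
    then have "transpose (block X i) + block X i = 0" by (simp add: sym_stack_def vec_eq_iff)
    then have "w \<bullet> ((transpose (block X i) + block X i) *v w) = 0" by simp
    then have "(block X i *v w) \<bullet> w + w \<bullet> (block X i *v w) = 0"
      by (simp only: matrix_vector_mult_add_rdistrib inner_add_right inner_transpose_vector)
    then show ?thesis by (simp add: inner_commute)
  qed
  then show ?thesis by (simp add: mult_kron_vec_blocks inner_sum_right)
qed

lemma frechet_derivative_quadratic_form:
  fixes P :: "real ^ 'a ^ 'a"
  assumes "transpose P = P"
  shows "frechet_derivative (\<lambda>w. w \<bullet> (P *v w)) (at w) h = 2 * (w \<bullet> (P *v h))"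
proof -
  have "((\<lambda>w. w \<bullet> (P *v w)) has_derivative (\<lambda>h. w \<bullet> (P *v h) + h \<bullet> (P *v w))) (at w)"
    by (intro has_derivative_inner has_derivative_ident
        bounded_linear.has_derivative[OF matrix_vector_mul_bounded_linear])
  moreover have "h \<bullet> (P *v w) = w \<bullet> (P *v h)" for h
    using inner_transpose_vector[of h P w] assms by (simp add: inner_commute)
  ultimately show ?thesis by (simp flip: frechet_derivative_at)
qed

text \<open>
  With a gauge for which \<open>G = 0\<close>, half the derivative of \<open>w\<^sup>T P w\<close> along the system is
  \<open>w\<^sup>T P A w + w\<^sup>T P H(w \<otimes> w)\<close>; the second term vanishes and the first is \<open>-|w|\<^sup>2 / 2\<close>.
\<close>

lemma zero_phi_imp_lyapunov:
  fixes D :: "('n::finite, 'k::finite) lift"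
  assumes rp: "represents_products D" and gb: "gauge_basis D" and cf: "certificate_factors D"
    and \<Lambda>: "\<Lambda> \<in> feasible D" and 0: "phi D \<Lambda> = 0"
  shows "global_quadratic_lyapunov (PL D \<Lambda>) (FL D \<Lambda>)"
proof -
  let ?A = "AL D \<Lambda>" and ?P = "PL D \<Lambda>" and ?F = "fac D \<Lambda>"
  note cert = lyapunov_certificate[OF cf \<Lambda>]
  obtain \<mu> where "phi D \<Lambda> = spectral_norm (JL D \<Lambda> \<mu>)" using phi_attained[OF gb cf \<Lambda>] by metis
  then have "JL D \<Lambda> \<mu> = 0" using 0 spectral_norm_eq_0_iff by metis
  then have "sym_stack (?P ** HL D \<Lambda> \<mu>) = 0"
    using JL_eq_0_iff[OF cf \<Lambda>] GL_eq_sym_stack[OF cert(3)] by metis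
  then have cubic: "w \<bullet> (?P *v (HL D \<Lambda> \<mu> *v kron_vec w w)) = 0" for w
    using sym_stack_eq_0_cubic by (simp add: matrix_vector_mul_assoc)
  have quadratic: "2 * (w \<bullet> (?P *v (?A *v w))) = - (w \<bullet> w)" for w
  proof -
    have "w \<bullet> ((transpose ?A ** ?P + ?P ** ?A) *v w)
        = w \<bullet> (transpose ?A *v (?P *v w)) + w \<bullet> (?P *v (?A *v w))"
      by (simp only: matrix_vector_mult_add_rdistrib inner_add_right matrix_vector_mul_assoc)
    also have "w \<bullet> (transpose ?A *v (?P *v w)) = w \<bullet> (?P *v (?A *v w))"
      using inner_transpose_vector[of w ?A "?P *v w"] inner_transpose_vector[of "?A *v w" ?P w]
      by (simp add: cert(3) inner_commute)
    finally show ?thesis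
      using matrix_vector_mult_diff_rdistrib[of 0 "mat 1" w] by (simp add: cert(1))
  qed
  have "0 < w \<bullet> (?P *v w)" if "w \<noteq> 0" for w
  proof -
    have "?F *v w \<noteq> 0"
      using cert(4) that by (metis invertible_left_inverse matrix_left_invertible_ker)
    moreover have "w \<bullet> (?P *v w) = (?F *v w) \<bullet> (?F *v w)"
      by (simp only: cert(2) inner_transpose_vector flip: matrix_vector_mul_assoc)
    ultimately show ?thesis by simp
  qed
  moreover have "frechet_derivative (\<lambda>w. w \<bullet> (?P *v w)) (at w) (FL D \<Lambda> w) < 0" if "w \<noteq> 0" for w
  proof -
    have "frechet_derivative (\<lambda>w. w \<bullet> (?P *v w)) (at w) (FL D \<Lambda> w)
        = 2 * (w \<bullet> (?P *v (?A *v w))) + 2 * (w \<bullet> (?P *v (HL D \<Lambda> \<mu> *v kron_vec w w)))"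
      by (simp add: frechet_derivative_quadratic_form[OF cert(3)] FL_quadratic_form[OF rp gb, of \<Lambda> w \<mu>]
          matrix_vector_right_distrib inner_add_right)
    then show ?thesis using that by (simp add: quadratic cubic)
  qed
  ultimately show ?thesis by (simp add: global_quadratic_lyapunov_def)
qed

section \<open>The lift near the origin\<close>

text \<open>
  The matrix of \<open>x \<mapsto> (x, 0)\<close>.
\<close>

definition incl :: "('n::finite, 'k::finite) lift \<Rightarrow> real ^ 'n ^ 'k" where
  "incl D = (\<chi> k j. of_bool (k = xi D j))"

lemma Phi_nth_xi:
  assumes "inner_quadratic_lift D"
  shows "Phi D x $ xi D j = x $ j"
proof -
  have inj: "inj (xi D)" and bij: "bij_betw (yi D) {..<ldim D} (- range (xi D))"
    using assms by (auto simp: inner_quadratic_lift_def)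
  have "yi D i \<noteq> xi D j" if "i < ldim D" for i
    using bij_betwE[OF bij] that by auto
  then have "(\<Sum>i<ldim D. axis (yi D i) (lift_monomial D i x)) $ xi D j = 0"
    by (simp add: axis_def eq_commute[of "xi D j"])
  then show ?thesis
    using inj by (simp add: Phi_def axis_def inj_eq sum.delta cong: if_cong)
qed

lemma Phi_nth_yi:
  assumes "inner_quadratic_lift D" "i < ldim D"
  shows "Phi D x $ yi D i = Phi D x $ fa D i * Phi D x $ fb D i"
proof -
  have bij: "bij_betw (yi D) {..<ldim D} (- range (xi D))"
    and prod: "lift_monomial D i x = Phi D x $ fa D i * Phi D x $ fb D i"
    using assms by (auto simp: inner_quadratic_lift_def)
  have 1: "xi D j \<noteq> yi D i" for j
    using bij_betwE[OF bij] assms(2) by (metis ComplD lessThan_iff rangeI)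
  have 2: "yi D i' = yi D i \<longleftrightarrow> i' = i" if "i' < ldim D" for i'
    using bij_betw_imp_inj_on[OF bij] that assms(2) by (auto simp: inj_on_def)
  have "Phi D x $ yi D i = (\<Sum>i'<ldim D. if i' = i then lift_monomial D i' x else 0)"
    unfolding Phi_def using 1 2 assms(2)
    by (auto simp: axis_def eq_commute[of "yi D i"] intro!: sum.cong)
  also have "\<dots> = lift_monomial D i x" using assms(2) by simp
  finally show ?thesis by (simp add: prod)
qed

lemma lift_coordinate_cases:
  assumes "inner_quadratic_lift D"
  obtains j where "k = xi D j" | i where "i < ldim D" "k = yi D i"
proof -
  have "bij_betw (yi D) {..<ldim D} (- range (xi D))"
    using assms by (simp add: inner_quadratic_lift_def)
  from bij_betw_imp_surj_on[OF this] show ?thesis using that by blast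
qed

text \<open>
  Induction along the factorizations \<open>g\<^sub>i = a\<^sub>i b\<^sub>i\<close>, whose factors are earlier coordinates.
\<close>

lemma lift_factor_induct:
  assumes D: "inner_quadratic_lift D" and i: "i < ldim D"
    and xi: "\<And>j. Q (xi D j)"
    and yi: "\<And>i. i < ldim D \<Longrightarrow> Q (fa D i) \<Longrightarrow> Q (fb D i) \<Longrightarrow> Q (yi D i)"
  shows "Q (fa D i)" "Q (fb D i)"
proof -
  have fac: "{fa D i, fb D i} \<subseteq> range (xi D) \<union> yi D ` {..<i}" if "i < ldim D" for i
    using D that by (simp add: inner_quadratic_lift_def)
  have "i < ldim D \<Longrightarrow> Q (fa D i) \<and> Q (fb D i)" for i
  proof (induction i rule: less_induct)
    case (less i)
    have "Q k" if "k \<in> range (xi D) \<union> yi D ` {..<i}" for k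
      using that xi yi less by auto
    then show ?case using fac[OF less.prems] by auto
  qed
  then show "Q (fa D i)" "Q (fb D i)" using i by auto
qed

text \<open>
  Each lifted coordinate is a product of two factors that are at most \<open>|x|\<close> in absolute value; on the unit
  ball its own bound \<open>|x|\<^sup>2\<close> is again at most \<open>|x|\<close>, so the induction continues.
\<close>

lemma abs_Phi_yi_le:
  assumes D: "inner_quadratic_lift D" and i: "i < ldim D" and x: "norm x \<le> 1"
  shows "\<bar>Phi D x $ yi D i\<bar> \<le> (norm x)\<^sup>2"
proof -
  have step: "\<bar>Phi D x $ yi D i\<bar> \<le> (norm x)\<^sup>2"
    if "i < ldim D" "\<bar>Phi D x $ fa D i\<bar> \<le> norm x" "\<bar>Phi D x $ fb D i\<bar> \<le> norm x" for i
    using mult_mono[OF that(2,3)] by (simp add: Phi_nth_yi[OF D that(1)] abs_mult power2_eq_square)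
  have "(norm x)\<^sup>2 \<le> norm x" using x by (simp add: power2_eq_square mult_left_le)
  then have "\<bar>Phi D x $ fa D i\<bar> \<le> norm x \<and> \<bar>Phi D x $ fb D i\<bar> \<le> norm x"
    using lift_factor_induct[OF D i, of "\<lambda>k. \<bar>Phi D x $ k\<bar> \<le> norm x"] step
    by (auto simp: Phi_nth_xi[OF D] component_le_norm_cart intro: order_trans)
  then show ?thesis using step i by blast
qed

lemma incl_mult_nth:
  assumes "inner_quadratic_lift D"
  shows "(incl D *v x) $ xi D j = x $ j" "i < ldim D \<Longrightarrow> (incl D *v x) $ yi D i = 0"
proof -
  have inj: "inj (xi D)" and bij: "bij_betw (yi D) {..<ldim D} (- range (xi D))"
    using assms by (auto simp: inner_quadratic_lift_def)
  show "(incl D *v x) $ xi D j = x $ j"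
    using inj by (simp add: incl_def matrix_vector_mult_def inj_eq of_bool_def sum.delta' if_distrib[of "\<lambda>y. y * _"] cong: if_cong)
  assume "i < ldim D"
  then have "yi D i \<noteq> xi D j" for j using bij_betwE[OF bij] by (metis ComplD lessThan_iff rangeI)
  then show "(incl D *v x) $ yi D i = 0" by (simp add: incl_def matrix_vector_mult_def)
qed

lemma transpose_incl_mult_nth: "(transpose (incl D) *v z) $ j = z $ xi D j"
  by (simp add: incl_def transpose_def matrix_vector_mult_def of_bool_def sum.delta
      if_distrib[of "\<lambda>y. y * _"] del: transpose_matrix_vector cong: if_cong)

lemma transpose_incl_incl:
  assumes "inner_quadratic_lift D"
  shows "transpose (incl D) ** incl D = mat 1"
  unfolding matrix_eq
  by (simp only: vec_eq_iff transpose_incl_mult_nth incl_mult_nth[OF assms] matrix_vector_mul_lid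
      flip: matrix_vector_mul_assoc) simp

lemma norm_incl_mult:
  assumes "inner_quadratic_lift D"
  shows "norm (incl D *v x) = norm x"
proof -
  have "(incl D *v x) \<bullet> (incl D *v x) = x \<bullet> (transpose (incl D) ** incl D *v x)"
    by (simp only: inner_transpose_vector flip: matrix_vector_mul_assoc)
  then show ?thesis by (simp add: transpose_incl_incl[OF assms] norm_eq_sqrt_inner)
qed

text \<open>
  \<open>x\<close> is the orthogonal projection of \<open>\<Phi>(x)\<close> to the first \<open>n\<close> coordinates.
\<close>

lemma norm_le_norm_Phi:
  assumes "inner_quadratic_lift D"
  shows "norm x \<le> norm (Phi D x)"
proof -
  have "transpose (incl D) *v Phi D x = x"
    by (simp only: vec_eq_iff transpose_incl_mult_nth Phi_nth_xi[OF assms]) simp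
  then have "norm x * norm x = x \<bullet> (transpose (incl D) *v Phi D x)"
    by (simp only: power2_norm_eq_inner[symmetric] power2_eq_square)
  also have "\<dots> = (incl D *v x) \<bullet> Phi D x" by (rule inner_transpose_vector)
  also have "\<dots> \<le> norm x * norm (Phi D x)"
    using norm_cauchy_schwarz[of "incl D *v x" "Phi D x"] by (simp add: norm_incl_mult[OF assms])
  finally show ?thesis by (cases "x = 0") auto
qed

lemma norm_Phi_diff_le:
  fixes D :: "('n::finite, 'k::finite) lift"
  assumes D: "inner_quadratic_lift D" and x: "norm x \<le> 1"
  shows "norm (Phi D x - incl D *v x) \<le> real CARD('k) * (norm x)\<^sup>2"
proof -
  have "\<bar>(Phi D x - incl D *v x) $ k\<bar> \<le> (norm x)\<^sup>2" for k
    using abs_Phi_yi_le[OF D _ x]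
    by (cases k rule: lift_coordinate_cases[OF D]) (auto simp: Phi_nth_xi[OF D] incl_mult_nth[OF D])
  then have "(\<Sum>k\<in>UNIV. \<bar>(Phi D x - incl D *v x) $ k\<bar>) \<le> (\<Sum>k\<in>(UNIV :: 'k set). (norm x)\<^sup>2)"
    by (intro sum_mono)
  from order_trans[OF norm_le_l1_cart this] show ?thesis by simp
qed

lemma has_derivative_at_0_quadratic:
  fixes f :: "'a::real_normed_vector \<Rightarrow> 'b::real_normed_vector"
  assumes "bounded_linear L" and bound: "\<And>x. norm x \<le> 1 \<Longrightarrow> norm (f x - L x) \<le> C * (norm x)\<^sup>2"
  shows "(f has_derivative L) (at 0)"
proof -
  interpret L: bounded_linear L by fact
  have "f 0 = 0" using bound[of 0] by (simp add: L.zero)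
  have "((\<lambda>h. norm (f (0 + h) - f 0 - L h) / norm h) \<longlongrightarrow> 0) (at 0)"
  proof (rule Lim_null_comparison)
    have "\<forall>\<^sub>F h::'a in at 0. norm h < 1"
      by (rule order_tendstoD(2)[of _ 0]) (auto intro: tendsto_eq_intros)
    then show "\<forall>\<^sub>F h in at 0. norm (norm (f (0 + h) - f 0 - L h) / norm h) \<le> C * norm h"
    proof eventually_elim
      case (elim h)
      then show ?case using bound[of h] \<open>f 0 = 0\<close>
        by (cases "h = 0") (auto simp: divide_le_eq power2_eq_square mult.assoc)
    qed
    show "((\<lambda>h::'a. C * norm h) \<longlongrightarrow> 0) (at 0)" by (auto intro!: tendsto_eq_intros)
  qed
  then show ?thesis using assms(1) by (simp add: has_derivative_at)
qed

lemma Phi_has_derivative_0: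
  assumes "inner_quadratic_lift D"
  shows "(Phi D has_derivative (*v) (incl D)) (at 0)"
  by (rule has_derivative_at_0_quadratic[OF matrix_vector_mul_bounded_linear norm_Phi_diff_le[OF assms]])

lemma Phi_0:
  assumes "inner_quadratic_lift D"
  shows "Phi D 0 = 0"
  using norm_Phi_diff_le[OF assms, of 0] by simp

lemma Phi_has_derivative:
  fixes D :: "('a::finite, 'b::finite) lift"
  shows "(Phi D has_derivative (*v) (jacobian (Phi D) (at x))) (at x)"
proof -
  have axis: "bounded_linear (axis k :: real \<Rightarrow> real ^ 'b)" for k
    unfolding linear_conv_bounded_linear[symmetric]
    by (rule linearI) (auto simp: axis_def vec_eq_iff)
  have "bounded_linear (\<lambda>x :: real ^ 'a. axis k (x $ j) :: real ^ 'b)" for k j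
    by (rule bounded_linear_compose[OF axis bounded_linear_vec_nth])
  moreover have "polynomial_function (\<lambda>x. axis k (lift_monomial D i x) :: real ^ 'b)" for k i
  proof -
    have "real_polynomial_function (lift_monomial D i)"
      unfolding lift_monomial_def
      by (intro real_polynomial_function_prod real_polynomial_function_power
          real_polynomial_function.intros(1) bounded_linear_vec_nth) auto
    moreover have "polynomial_function (axis k :: real \<Rightarrow> real ^ 'b)"
      by (rule polynomial_function_bounded_linear[OF axis])
    ultimately show ?thesis
      using polynomial_function_compose[of "lift_monomial D i" "axis k"] 
      by (simp add: o_def real_polynomial_function_eq)
  qed
  ultimately have "polynomial_function (Phi D)"
    unfolding Phi_def[abs_def]
    by (intro polynomial_function_add polynomial_function_sum)
      (auto intro: polynomial_function_bounded_linear)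
  then have "Phi D differentiable (at x)" by (rule differentiable_at_polynomial_function)
  then show ?thesis by (simp add: jacobian_works)
qed

lemma jacobian_Phi_xi:
  assumes "inner_quadratic_lift D"
  shows "(jacobian (Phi D) (at x) *v h) $ xi D j = h $ j"
proof -
  have "((\<lambda>x. Phi D x $ xi D j) has_derivative (\<lambda>h. (jacobian (Phi D) (at x) *v h) $ xi D j)) (at x)"
    by (rule bounded_linear.has_derivative[OF bounded_linear_vec_nth Phi_has_derivative])
  moreover have "((\<lambda>x. Phi D x $ xi D j) has_derivative (\<lambda>h. h $ j)) (at x)"
    unfolding Phi_nth_xi[OF assms]
    by (rule bounded_linear.has_derivative[OF bounded_linear_vec_nth has_derivative_ident])
  ultimately show ?thesis by (metis has_derivative_unique)
qed

lemma jacobian_Phi_yi: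
  assumes "inner_quadratic_lift D" "i < ldim D"
  shows "(jacobian (Phi D) (at x) *v h) $ yi D i =
    Phi D x $ fa D i * (jacobian (Phi D) (at x) *v h) $ fb D i
    + (jacobian (Phi D) (at x) *v h) $ fa D i * Phi D x $ fb D i"
proof -
  let ?d = "\<lambda>k h. (jacobian (Phi D) (at x) *v h) $ k"
  have comp: "((\<lambda>x. Phi D x $ k) has_derivative ?d k) (at x)" for k
    by (rule bounded_linear.has_derivative[OF bounded_linear_vec_nth Phi_has_derivative])
  have "((\<lambda>x. Phi D x $ yi D i) has_derivative
      (\<lambda>h. Phi D x $ fa D i * ?d (fb D i) h + ?d (fa D i) h * Phi D x $ fb D i)) (at x)"
    unfolding Phi_nth_yi[OF assms] by (rule has_derivative_mult[OF comp comp])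
  with comp[of "yi D i"] show ?thesis by (metis (no_types, lifting) has_derivative_unique)
qed

text \<open>
  By the product rule, the derivative of a product of two coordinates that are at most \<open>|x|\<close>, with bounded
  derivatives, is at most a multiple of \<open>|x|\<close>. The induction carries both bounds, collected in \<open>R\<close>.
\<close>

lemma jacobian_Phi_yi_bound:
  assumes D: "inner_quadratic_lift D" and i: "i < ldim D"
  shows "\<exists>M. \<forall>x h. norm x \<le> 1 \<longrightarrow> \<bar>(jacobian (Phi D) (at x) *v h) $ yi D i\<bar> \<le> M * norm x * norm h"
proof -
  let ?d = "\<lambda>x k h. (jacobian (Phi D) (at x) *v h) $ k"
  define R where "R k \<longleftrightarrow> (\<forall>x. norm x \<le> 1 \<longrightarrow> \<bar>Phi D x $ k\<bar> \<le> norm x) \<and>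
      (\<exists>M. \<forall>x h. norm x \<le> 1 \<longrightarrow> \<bar>?d x k h\<bar> \<le> M * norm h)" for k
  have step: "\<exists>M\<ge>0. \<forall>x h. norm x \<le> 1 \<longrightarrow> \<bar>?d x (yi D i) h\<bar> \<le> M * norm x * norm h"
    if i: "i < ldim D" and R: "R (fa D i)" "R (fb D i)" for i
  proof -
    obtain Ma Mb where M: "\<And>x h. norm x \<le> 1 \<Longrightarrow> \<bar>?d x (fa D i) h\<bar> \<le> Ma * norm h"
       "\<And>x h. norm x \<le> 1 \<Longrightarrow> \<bar>?d x (fb D i) h\<bar> \<le> Mb * norm h"
      using R unfolding R_def by blast
    have \<Phi>: "\<bar>Phi D x $ fa D i\<bar> \<le> norm x" "\<bar>Phi D x $ fb D i\<bar> \<le> norm x" if "norm x \<le> 1" for x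
      using R that unfolding R_def by auto
    have "\<bar>?d x (yi D i) h\<bar> \<le> (\<bar>Ma\<bar> + \<bar>Mb\<bar>) * norm x * norm h" if x: "norm x \<le> 1" for x h
    proof -
      have "\<bar>?d x (yi D i) h\<bar> \<le> \<bar>Phi D x $ fa D i\<bar> * \<bar>?d x (fb D i) h\<bar> + \<bar>?d x (fa D i) h\<bar> * \<bar>Phi D x $ fb D i\<bar>"
        unfolding jacobian_Phi_yi[OF D i] by (simp add: abs_triangle_ineq abs_mult flip: abs_mult)
      also have "\<dots> \<le> norm x * (\<bar>Mb\<bar> * norm h) + (\<bar>Ma\<bar> * norm h) * norm x"
      proof -
        have "Ma * norm h \<le> \<bar>Ma\<bar> * norm h" "Mb * norm h \<le> \<bar>Mb\<bar> * norm h"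
          by (intro mult_right_mono; simp)+
        then show ?thesis
          using \<Phi>[OF x] M(1)[OF x, of h] M(2)[OF x, of h] by (intro add_mono mult_mono) auto
      qed
      finally show ?thesis by (simp add: algebra_simps)
    qed
    then show ?thesis by (intro exI[of _ "\<bar>Ma\<bar> + \<bar>Mb\<bar>"]) auto
  qed
  have xi: "R (xi D j)" for j
    unfolding R_def using component_le_norm_cart
    by (auto simp: Phi_nth_xi[OF D] jacobian_Phi_xi[OF D] intro!: exI[of _ 1])
  have yi: "R (yi D i)" if i: "i < ldim D" and R: "R (fa D i)" "R (fb D i)" for i
  proof -
    obtain M where M: "M \<ge> 0" "\<And>x h. norm x \<le> 1 \<Longrightarrow> \<bar>?d x (yi D i) h\<bar> \<le> M * norm x * norm h"
      using step[OF i R] by blast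
    have "\<bar>?d x (yi D i) h\<bar> \<le> M * norm h" if "norm x \<le> 1" for x h
      using M(2)[OF that, of h] mult_right_mono[OF mult_left_mono[OF that M(1)], of "norm h"] by simp
    moreover have "\<bar>Phi D x $ yi D i\<bar> \<le> norm x" if "norm x \<le> 1" for x
      using abs_Phi_yi_le[OF D i that] that mult_left_le[of "norm x" "norm x"] by (simp add: power2_eq_square)
    ultimately show ?thesis unfolding R_def by blast
  qed
  show ?thesis
    using step[OF i] lift_factor_induct[OF D i, of R] xi yi by blast
qed

lemma bounded_bilinear_kron_vec:
  "bounded_bilinear (kron_vec :: real ^ 'a \<Rightarrow> real ^ 'b \<Rightarrow> real ^ ('a \<times> 'b))"
  unfolding bilinear_conv_bounded_bilinear[symmetric] bilinear_def
  by (auto intro!: linearI simp: vec_eq_iff kron_vec_def algebra_simps)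

lemma F0_Phi_has_derivative_0:
  assumes "inner_quadratic_lift D"
  shows "((\<lambda>x. F0 D (Phi D x)) has_derivative (\<lambda>h. A0 D *v (incl D *v h))) (at 0)"
proof -
  note d = Phi_has_derivative_0[OF assms]
  have "((\<lambda>x. A0 D *v Phi D x + H0 D *v kron_vec (Phi D x) (Phi D x)) has_derivative
      (\<lambda>h. A0 D *v (incl D *v h) + H0 D *v (kron_vec (Phi D 0) (incl D *v h) + kron_vec (incl D *v h) (Phi D 0)))) (at 0)"
    by (intro has_derivative_add bounded_linear.has_derivative[OF matrix_vector_mul_bounded_linear]
        bounded_bilinear.FDERIV[OF bounded_bilinear_kron_vec] d)
  then show ?thesis
    by (simp add: F0_def Phi_0[OF assms] bounded_bilinear.zero_left[OF bounded_bilinear_kron_vec]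
        bounded_bilinear.zero_right[OF bounded_bilinear_kron_vec])
qed

text \<open>
  Both sides of \<open>F\<^sub>0(\<Phi>(x)) = J(\<Phi>)(x) p(x)\<close> are differentiated at 0. On the left the quadratic part drops out
  because \<open>\<Phi>(0) = 0\<close>. On the right a row of an original coordinate is \<open>p\<^sub>j\<close>, with derivative a row of
  \<open>J\<^sub>p\<close>, and a row of a lifted coordinate is \<open>O(|x| |p(x)|) = o(|x|)\<close>.
\<close>

lemma A0_incl:
  fixes D :: "('n::finite, 'k::finite) lift"
  assumes p: "polynomial_function p" "p 0 = 0" and D: "inner_quadratic_lift D" and ref: "reference_extension p D"
  shows "A0 D *v (incl D *v h) = incl D *v (jacobian p (at 0) *v h)"
proof -
  have dp: "(p has_derivative (*v) (jacobian p (at 0))) (at 0)"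
    using differentiable_at_polynomial_function[OF p(1)] by (simp add: jacobian_works)
  have F: "((\<lambda>x. (jacobian (Phi D) (at x) *v p x) $ k) has_derivative (\<lambda>h. (A0 D *v (incl D *v h)) $ k)) (at 0)" for k
    using bounded_linear.has_derivative[OF bounded_linear_vec_nth F0_Phi_has_derivative_0[OF D]] ref
    by (simp add: reference_extension_def)
  have "(A0 D *v (incl D *v h)) $ k = (incl D *v (jacobian p (at 0) *v h)) $ k" for k
  proof (cases k rule: lift_coordinate_cases[OF D])
    case (1 j)
    have "((\<lambda>x. p x $ j) has_derivative (\<lambda>h. (jacobian p (at 0) *v h) $ j)) (at 0)"
      by (rule bounded_linear.has_derivative[OF bounded_linear_vec_nth dp])
    moreover have "((\<lambda>x. p x $ j) has_derivative (\<lambda>h. (A0 D *v (incl D *v h)) $ k)) (at 0)"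
      using F[of k] by (simp only: 1 jacobian_Phi_xi[OF D])
    ultimately have "(\<lambda>h. (jacobian p (at 0) *v h) $ j) = (\<lambda>h. (A0 D *v (incl D *v h)) $ k)"
      by (rule has_derivative_unique)
    from fun_cong[OF this, of h] show ?thesis by (simp add: 1 incl_mult_nth[OF D])
  next
    case (2 i)
    let ?r = "\<lambda>x. (jacobian (Phi D) (at x) *v p x) $ yi D i"
    obtain M where M: "\<And>x h. norm x \<le> 1 \<Longrightarrow> \<bar>(jacobian (Phi D) (at x) *v h) $ yi D i\<bar> \<le> M * norm x * norm h"
      using jacobian_Phi_yi_bound[OF D 2(1)] by blast
    have "((\<lambda>h. norm (?r (0 + h) - ?r 0 - 0) / norm h) \<longlongrightarrow> 0) (at 0)"
    proof (rule Lim_null_comparison)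
      have "\<forall>\<^sub>F h::real ^ 'n in at 0. norm h < 1"
        by (rule order_tendstoD(2)[of _ 0]) (auto intro: tendsto_eq_intros)
      then show "\<forall>\<^sub>F h in at 0. norm (norm (?r (0 + h) - ?r 0 - 0) / norm h) \<le> M * norm (p h)"
      proof eventually_elim
        case (elim h)
        then show ?case using M[of h "p h"] p(2)
          by (cases "h = 0") (auto simp: divide_le_eq mult_ac)
      qed
      have "(p \<longlongrightarrow> p 0) (at 0)"
        using has_derivative_continuous[OF dp] by (simp add: continuous_within)
      then have "((\<lambda>h. norm (p h)) \<longlongrightarrow> 0) (at 0)" using p(2) tendsto_norm_zero by auto
      then show "((\<lambda>h. M * norm (p h)) \<longlongrightarrow> 0) (at 0)" by (rule tendsto_mult_right_zero)
    qed
    then have "(?r has_derivative (\<lambda>h. 0)) (at 0)" by (simp add: has_derivative_at)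
    then have "(\<lambda>h. (A0 D *v (incl D *v h)) $ k) = (\<lambda>h. 0)"
      using F[of k] 2(2) has_derivative_unique by blast
    then show ?thesis using 2 by (simp add: incl_mult_nth[OF D] fun_eq_iff)
  qed
  then show ?thesis by (simp add: vec_eq_iff)
qed

section \<open>Volumes of the pullbacks\<close>

text \<open>
  With \<open>E\<close> the inclusion, \<open>A(\<Lambda>) E = E J\<^sub>p\<close>: the gains act on lifted coordinates only, so this is \<open>A0_incl\<close>.
  Compressing the Lyapunov equation of \<open>A(\<Lambda>)\<close> by \<open>E\<close> therefore gives that of \<open>J\<^sub>p\<close>.
\<close>

lemma lyap_sol_leading_block:
  fixes D :: "('n::finite, 'k::finite) lift"
  assumes p: "polynomial_function p" "p 0 = 0" and hur: "hurwitz (jacobian p (at 0))"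
    and D: "inner_quadratic_lift D" and ref: "reference_extension p D"
    and cf: "certificate_factors D" and \<Lambda>: "\<Lambda> \<in> feasible D"
  shows "lyap_sol (jacobian p (at 0)) = transpose (incl D) ** PL D \<Lambda> ** incl D"
proof (rule lyap_sol_unique[OF hur])
  let ?J = "jacobian p (at 0)" and ?E = "incl D" and ?A = "AL D \<Lambda>" and ?P = "PL D \<Lambda>"
  have "?A *v (?E *v h) = ?E *v (?J *v h)" for h
  proof -
    have "?A *v (?E *v h) = A0 D *v (?E *v h) - (\<Sum>i<ldim D. (\<Lambda> i * (?E *v h) $ yi D i) *\<^sub>R axis (yi D i) 1)"
      by (simp add: AL_def matrix_vector_mult_diff_rdistrib matrix_vector_mult_sum_left
          outer_vector_mult inner_axis' flip: scaleR_matrix_vector_assoc)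
    then show ?thesis by (simp add: incl_mult_nth[OF D] A0_incl[OF p D ref])
  qed
  then have AE: "?A ** ?E = ?E ** ?J" by (simp add: matrix_eq flip: matrix_vector_mul_assoc)
  then have EA: "transpose ?E ** transpose ?A = transpose ?J ** transpose ?E"
    by (metis matrix_transpose_mul)
  have "transpose ?J ** (transpose ?E ** ?P ** ?E) + (transpose ?E ** ?P ** ?E) ** ?J
      = (transpose ?J ** transpose ?E) ** ?P ** ?E + transpose ?E ** ?P ** (?E ** ?J)"
    by (simp only: matrix_mul_assoc)
  also have "\<dots> = transpose ?E ** (transpose ?A ** ?P + ?P ** ?A) ** ?E"
    by (simp only: AE[symmetric] EA[symmetric] matrix_mul_assoc matrix_add_ldistrib bounded_bilinear.add_left[OF bounded_bilinear_matrix_mult])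
  also have "\<dots> = - (transpose ?E ** ?E)"
    unfolding lyapunov_certificate(1)[OF cf \<Lambda>]
    by (simp add: bounded_bilinear.minus_left[OF bounded_bilinear_matrix_mult]
        bounded_bilinear.minus_right[OF bounded_bilinear_matrix_mult])
  also have "\<dots> = - mat 1" by (simp add: transpose_incl_incl[OF D])
  finally show "transpose ?J ** (transpose ?E ** ?P ** ?E) + (transpose ?E ** ?P ** ?E) ** ?J = - mat 1" .
qed

text \<open>
  \<open>|F \<Phi>(x) - F (x, 0)|\<close> is at most \<open>K N |x|\<^sup>2\<close>, hence small against \<open>b |x| \<le> |F (x, 0)| = |Q x|\<close>.
\<close>

lemma sublevel_volume_limit:
  fixes D :: "('n::finite, 'k::finite) lift"
  assumes D: "inner_quadratic_lift D" and F: "invertible F"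
  shows "0 < det (transpose (incl D) ** (transpose F ** F) ** incl D)"
    and "((\<lambda>r. measure lebesgue {x. norm (F *v Phi D x) \<le> r} / r ^ CARD('n))
      \<longlongrightarrow> unit_ball_vol (real CARD('n)) / sqrt (det (transpose (incl D) ** (transpose F ** F) ** incl D))) (at_right 0)"
proof -
  let ?E = "incl D"
  obtain b where b: "b > 0" "\<And>v. b * norm v \<le> norm (F *v v)"
    using linear_inj_bounded_below_pos[OF matrix_vector_mul_linear inj_matrix_vector_mult[OF F]] by blast
  have "inj ((*v) (F ** ?E))"
    unfolding linear_injective_0[OF matrix_vector_mul_linear]
  proof (intro allI impI)
    fix x assume "F ** ?E *v x = 0"
    then have "F *v (?E *v x) = 0" by (simp add: matrix_vector_mul_assoc)
    then have "norm (?E *v x) = 0" using b(2)[of "?E *v x"] b(1) by (simp add: mult_le_0_iff)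
    then show "x = 0" by (simp add: norm_incl_mult[OF D])
  qed
  from gram_square_factor[OF this] obtain Q :: "real ^ 'n ^ 'n" where Q: "invertible Q"
    "\<And>x. norm (Q *v x) = norm (F ** ?E *v x)" "transpose Q ** Q = transpose (F ** ?E) ** (F ** ?E)"
    by blast
  have "det (transpose ?E ** (transpose F ** F) ** ?E) = det (transpose Q ** Q)"
    unfolding Q(3) by (simp add: matrix_transpose_mul matrix_mul_assoc)
  then have det: "det (transpose ?E ** (transpose F ** F) ** ?E) = (det Q)\<^sup>2"
    by (simp add: det_mul power2_eq_square)
  then show "0 < det (transpose ?E ** (transpose F ** F) ** ?E)"
    using Q(1) by (simp add: invertible_det_nz)
  obtain K where K: "K > 0" "\<And>v. norm (F *v v) \<le> K * norm v"
    using linear_bounded_pos[OF matrix_vector_mul_linear[of F]] by blast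
  have "((\<lambda>r. measure lebesgue {x. norm (F *v Phi D x) \<le> r} / r ^ CARD('n))
      \<longlongrightarrow> unit_ball_vol (real CARD('n)) / \<bar>det Q\<bar>) (at_right 0)"
  proof (rule volume_sublevel_asymptotics[OF _ b(1) _ Q(1)])
    have "isCont (Phi D) x" for x
      using has_derivative_continuous[OF Phi_has_derivative] by blast
    then have "continuous_on UNIV (Phi D)" by (simp add: continuous_at_imp_continuous_on)
    then show "continuous_on UNIV (\<lambda>x. F *v Phi D x)"
      by (rule continuous_on_linear_comp[OF _ matrix_vector_mul_linear])
    show "b * norm x \<le> norm (F *v Phi D x)" for x
    proof -
      have "b * norm x \<le> b * norm (Phi D x)" using norm_le_norm_Phi[OF D] b(1) by simp
      then show ?thesis using b(2) order_trans by blast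
    qed
    fix e :: real assume "e > 0"
    define d where "d = min 1 (e * b / (K * real CARD('k)))"
    have "d > 0" using \<open>e > 0\<close> b(1) K(1) by (simp add: d_def)
    moreover have "\<bar>norm (F *v Phi D x) - norm (Q *v x)\<bar> \<le> e * norm (Q *v x)" if x: "norm x < d" for x
    proof -
      have "\<bar>norm (F *v Phi D x) - norm (Q *v x)\<bar> \<le> norm (F *v (Phi D x - ?E *v x))"
        unfolding Q(2) matrix_vector_mult_diff_distrib matrix_vector_mul_assoc by (rule norm_triangle_ineq3)
      also have "\<dots> \<le> K * (real CARD('k) * (norm x)\<^sup>2)"
        using K norm_Phi_diff_le[OF D, of x] x by (intro order_trans[OF K(2)] mult_left_mono) (auto simp: d_def)
      also have "\<dots> = K * real CARD('k) * norm x * norm x" by (simp add: power2_eq_square)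
      also have "\<dots> \<le> e * b * norm x"
      proof (rule mult_right_mono)
        have "norm x \<le> e * b / (K * real CARD('k))" using x by (simp add: d_def)
        then show "K * real CARD('k) * norm x \<le> e * b" using K(1) by (simp add: field_simps)
      qed simp
      also have "\<dots> \<le> e * norm (Q *v x)"
        using b(2)[of "?E *v x"] \<open>e > 0\<close>
        by (simp add: Q(2) norm_incl_mult[OF D] mult.assoc flip: matrix_vector_mul_assoc)
      finally show ?thesis .
    qed
    ultimately show "\<exists>d>0. \<forall>x. norm x < d \<longrightarrow> \<bar>norm (F *v Phi D x) - norm (Q *v x)\<bar> \<le> e * norm (Q *v x)"
      by blast
  qed
  then show "((\<lambda>r. measure lebesgue {x. norm (F *v Phi D x) \<le> r} / r ^ CARD('n))
      \<longlongrightarrow> unit_ball_vol (real CARD('n)) / sqrt (det (transpose ?E ** (transpose F ** F) ** ?E))) (at_right 0)"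
    by (simp add: det)
qed

lemma rho_star_eq: "0 < phi D \<Lambda> \<Longrightarrow> rho_star D \<Lambda> = ereal (1 / phi D \<Lambda>)"
  by (simp add: rho_star_def one_ereal_def)

lemma pullback_eq_sublevel:
  assumes "certificate_factors D" "\<Lambda> \<in> feasible D" "0 \<le> r"
  shows "pullback D \<Lambda> (ereal r) = {x. norm (fac D \<Lambda> *v Phi D x) \<le> r}"
proof -
  have "v \<bullet> (PL D \<Lambda> *v v) = (norm (fac D \<Lambda> *v v))\<^sup>2" for v
    by (simp only: lyapunov_certificate(2)[OF assms(1,2)] inner_transpose_vector power2_norm_eq_inner
        flip: matrix_vector_mul_assoc)
  then show ?thesis
    using assms(3) by (simp add: pullback_def power_mono_iff)
qed

text \<open>
  The limit of \<open>sublevel_volume_limit\<close> along \<open>r = \<epsilon> \<rho>\<^sup>\<star>\<close>.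
\<close>

lemma pullback_volume_expansion:
  fixes D :: "('n::finite, 'k::finite) lift"
  assumes p: "polynomial_function p" "p 0 = 0" and hur: "hurwitz (jacobian p (at 0))"
    and D: "inner_quadratic_lift D" and ref: "reference_extension p D"
    and cf: "certificate_factors D" and \<Lambda>: "\<Lambda> \<in> feasible D" and pos: "0 < phi D \<Lambda>"
  shows "(\<lambda>\<epsilon>. measure lebesgue (pullback D \<Lambda> (ereal \<epsilon> * rho_star D \<Lambda>))
                      - volume_coeff p D \<Lambda> * \<epsilon> ^ CARD('n))
                 \<in> o[at_right 0](\<lambda>\<epsilon>. \<epsilon> ^ CARD('n))"
proof -
  let ?n = "CARD('n)"
  define \<rho> where "\<rho> = 1 / phi D \<Lambda>"
  have \<rho>: "\<rho> > 0" "rho_star D \<Lambda> = ereal \<rho>" using pos by (auto simp: \<rho>_def rho_star_eq)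
  define V where "V = unit_ball_vol (real CARD('n)) / sqrt (det (lyap_sol (jacobian p (at 0))))"
  define m where "m r = measure lebesgue {x. norm (fac D \<Lambda> *v Phi D x) \<le> r}" for r
  have "lyap_sol (jacobian p (at 0)) = transpose (incl D) ** (transpose (fac D \<Lambda>) ** fac D \<Lambda>) ** incl D"
    using lyap_sol_leading_block[OF p hur D ref cf \<Lambda>] lyapunov_certificate(2)[OF cf \<Lambda>] by simp
  then have "((\<lambda>r. m r / r ^ ?n) \<longlongrightarrow> V) (at_right 0)"
    using sublevel_volume_limit(2)[OF D lyapunov_certificate(4)[OF cf \<Lambda>]] by (simp add: m_def V_def)
  moreover have "filterlim (\<lambda>\<epsilon>. \<epsilon> * \<rho>) (at_right 0) (at_right 0)"
    unfolding filterlim_at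
  proof (intro conjI)
    show "((\<lambda>\<epsilon>. \<epsilon> * \<rho>) \<longlongrightarrow> 0) (at_right 0)" by (auto intro!: tendsto_eq_intros)
    show "\<forall>\<^sub>F \<epsilon> in at_right 0. \<epsilon> * \<rho> \<in> {0<..} \<and> \<epsilon> * \<rho> \<noteq> 0"
      using eventually_at_right_less by eventually_elim (use \<rho>(1) in auto)
  qed
  ultimately have "((\<lambda>\<epsilon>. m (\<epsilon> * \<rho>) / (\<epsilon> * \<rho>) ^ ?n) \<longlongrightarrow> V) (at_right 0)"
    by (rule filterlim_compose)
  then have "((\<lambda>\<epsilon>. (m (\<epsilon> * \<rho>) / (\<epsilon> * \<rho>) ^ ?n - V) * \<rho> ^ ?n) \<longlongrightarrow> (V - V) * \<rho> ^ ?n) (at_right 0)"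
    by (intro tendsto_intros)
  moreover have "\<forall>\<^sub>F \<epsilon> in at_right 0. (m (\<epsilon> * \<rho>) / (\<epsilon> * \<rho>) ^ ?n - V) * \<rho> ^ ?n
      = (measure lebesgue (pullback D \<Lambda> (ereal \<epsilon> * rho_star D \<Lambda>)) - volume_coeff p D \<Lambda> * \<epsilon> ^ ?n) / \<epsilon> ^ ?n"
    using eventually_at_right_less
  proof eventually_elim
    case (elim \<epsilon>)
    have "pullback D \<Lambda> (ereal \<epsilon> * rho_star D \<Lambda>) = {x. norm (fac D \<Lambda> *v Phi D x) \<le> \<epsilon> * \<rho>}"
      using pullback_eq_sublevel[OF cf \<Lambda>, of "\<epsilon> * \<rho>"] elim \<rho> by simp
    moreover have "volume_coeff p D \<Lambda> = V * \<rho> ^ ?n"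
      by (simp add: volume_coeff_def V_def \<rho>(2))
    ultimately show ?case
      using elim \<rho>(1) by (simp add: m_def power_mult_distrib field_simps)
  qed
  ultimately have "((\<lambda>\<epsilon>. (measure lebesgue (pullback D \<Lambda> (ereal \<epsilon> * rho_star D \<Lambda>))
      - volume_coeff p D \<Lambda> * \<epsilon> ^ ?n) / \<epsilon> ^ ?n) \<longlongrightarrow> 0) (at_right 0)"
    using Lim_transform_eventually by fastforce
  moreover have "\<forall>\<^sub>F \<epsilon>::real in at_right 0. \<epsilon> ^ ?n \<noteq> 0"
    using eventually_at_right_less by eventually_elim simp
  ultimately show ?thesis by (rule smalloI_tendsto)
qed

text \<open>
  The coefficient is a positive constant times \<open>(1 / \<phi>)\<^sup>n\<close>, and the constant is the same for all gains.
\<close>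

lemma ranking_by_volume_coeff:
  fixes D :: "('n::finite, 'k::finite) lift"
  assumes p: "polynomial_function p" "p 0 = 0" and hur: "hurwitz (jacobian p (at 0))"
    and D: "inner_quadratic_lift D" and ref: "reference_extension p D"
    and cf: "certificate_factors D" and \<Lambda>: "\<Lambda>1 \<in> feasible D" "\<Lambda>2 \<in> feasible D"
    and pos: "0 < phi D \<Lambda>1" "0 < phi D \<Lambda>2"
  shows "phi D \<Lambda>2 \<le> phi D \<Lambda>1 \<longleftrightarrow> rho_star D \<Lambda>1 \<le> rho_star D \<Lambda>2"
    and "rho_star D \<Lambda>1 \<le> rho_star D \<Lambda>2 \<longleftrightarrow> volume_coeff p D \<Lambda>1 \<le> volume_coeff p D \<Lambda>2"
proof -
  have "det (lyap_sol (jacobian p (at 0))) > 0"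
    using sublevel_volume_limit(1)[OF D lyapunov_certificate(4)[OF cf \<Lambda>(1)]]
      lyap_sol_leading_block[OF p hur D ref cf \<Lambda>(1)] lyapunov_certificate(2)[OF cf \<Lambda>(1)] by simp
  then have V: "0 < unit_ball_vol (real CARD('n)) / sqrt (det (lyap_sol (jacobian p (at 0))))"
    by simp
  show "phi D \<Lambda>2 \<le> phi D \<Lambda>1 \<longleftrightarrow> rho_star D \<Lambda>1 \<le> rho_star D \<Lambda>2"
    using pos by (simp add: rho_star_eq field_simps)
  have "volume_coeff p D \<Lambda> = unit_ball_vol (real CARD('n)) / sqrt (det (lyap_sol (jacobian p (at 0))))
      * (1 / phi D \<Lambda>) ^ CARD('n)" if "0 < phi D \<Lambda>" for \<Lambda>
    using that by (simp add: volume_coeff_def rho_star_eq)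
  then have "volume_coeff p D \<Lambda>1 \<le> volume_coeff p D \<Lambda>2
      \<longleftrightarrow> (1 / phi D \<Lambda>1) ^ CARD('n) \<le> (1 / phi D \<Lambda>2) ^ CARD('n)"
    using pos V by (simp only: mult_le_cancel_left_pos)
  also have "\<dots> \<longleftrightarrow> 1 / phi D \<Lambda>1 \<le> 1 / phi D \<Lambda>2"
    using pos by (intro power_mono_iff) auto
  finally show "rho_star D \<Lambda>1 \<le> rho_star D \<Lambda>2 \<longleftrightarrow> volume_coeff p D \<Lambda>1 \<le> volume_coeff p D \<Lambda>2"
    using pos by (simp add: rho_star_eq)
qed

theorem corollary3p16:
  fixes p :: "real ^ 'n \<Rightarrow> real ^ 'n"
    and D :: "('n::finite, 'k::finite) lift"
    and B :: "(nat \<Rightarrow> real) set"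
  assumes "polynomial_function p" and "p 0 = 0" and "hurwitz (jacobian p (at 0))"
    and "inner_quadratic_lift D"
    and "reference_extension p D"
    and "represents_products D"
    and "gauge_basis D"
    and "certificate_factors D"
    and "admissible_gain_box D B"
  shows "(0 < phi_box D B \<longrightarrow>
            (\<forall>\<Lambda>\<in>B.
               (\<lambda>\<epsilon>. measure lebesgue (pullback D \<Lambda> (ereal \<epsilon> * rho_star D \<Lambda>))
                      - volume_coeff p D \<Lambda> * \<epsilon> ^ CARD('n))
                 \<in> o[at_right 0](\<lambda>\<epsilon>. \<epsilon> ^ CARD('n))) \<and>
            (\<forall>\<Lambda>1\<in>B. \<forall>\<Lambda>2\<in>B.
               (phi D \<Lambda>2 \<le> phi D \<Lambda>1 \<longleftrightarrow> rho_star D \<Lambda>1 \<le> rho_star D \<Lambda>2) \<and>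
               (rho_star D \<Lambda>1 \<le> rho_star D \<Lambda>2 \<longleftrightarrow> volume_coeff p D \<Lambda>1 \<le> volume_coeff p D \<Lambda>2)))
       \<and> (phi_box D B = 0 \<longrightarrow>
            (\<exists>\<Lambda>\<in>B. phi D \<Lambda> = phi_box D B \<and> global_quadratic_lyapunov (PL D \<Lambda>) (FL D \<Lambda>)))"
proof -
  have feas: "\<Lambda> \<in> feasible D" if "\<Lambda> \<in> B" for \<Lambda>
    using assms(9) that by (auto simp: admissible_gain_box_def)
  obtain \<Lambda>0 where \<Lambda>0: "\<Lambda>0 \<in> B" "phi_box D B = phi D \<Lambda>0"
    and least: "\<And>\<Lambda>. \<Lambda> \<in> B \<Longrightarrow> phi_box D B \<le> phi D \<Lambda>"
    using phi_box_attained[OF assms(7-9)] by metis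
  have pos: "0 < phi D \<Lambda>" if "0 < phi_box D B" "\<Lambda> \<in> B" for \<Lambda>
    using least[OF that(2)] that(1) by linarith
  show ?thesis
  proof (intro conjI impI ballI)
    fix \<Lambda> assume "0 < phi_box D B" "\<Lambda> \<in> B"
    then show "(\<lambda>\<epsilon>. measure lebesgue (pullback D \<Lambda> (ereal \<epsilon> * rho_star D \<Lambda>))
        - volume_coeff p D \<Lambda> * \<epsilon> ^ CARD('n)) \<in> o[at_right 0](\<lambda>\<epsilon>. \<epsilon> ^ CARD('n))"
      by (intro pullback_volume_expansion[OF assms(1-5,8)] feas pos)
  next
    fix \<Lambda>1 \<Lambda>2 assume "0 < phi_box D B" "\<Lambda>1 \<in> B" "\<Lambda>2 \<in> B"
    note ranking = ranking_by_volume_coeff[OF assms(1-5,8) feas[OF this(2)] feas[OF this(3)]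
        pos[OF this(1,2)] pos[OF this(1,3)]]
    show "phi D \<Lambda>2 \<le> phi D \<Lambda>1 \<longleftrightarrow> rho_star D \<Lambda>1 \<le> rho_star D \<Lambda>2"
      and "rho_star D \<Lambda>1 \<le> rho_star D \<Lambda>2 \<longleftrightarrow> volume_coeff p D \<Lambda>1 \<le> volume_coeff p D \<Lambda>2"
      by (fact ranking)+
  next
    assume "phi_box D B = 0"
    then show "\<exists>\<Lambda>\<in>B. phi D \<Lambda> = phi_box D B \<and> global_quadratic_lyapunov (PL D \<Lambda>) (FL D \<Lambda>)"
      using \<Lambda>0 zero_phi_imp_lyapunov[OF assms(6-8) feas[OF \<Lambda>0(1)]] by auto
  qed
qed

end
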